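(* The matrix $A$ is $Q$-polynomial with respect to the vertex $\mathbf 0$. That is, there exist an ordering $F_0,F_1,\dots,F_N$ of the primitive idempotents of $A$ and a matrix $B\in\mathrm{Mat}_X(\mathbb R)$ such that $B$ generates the algebra $M^*$ and $$B F_iV\subseteq F_{i-1}V+F_iV+F_{i+1}V\qquad (0\le i\le N),$$ where $F_{-1}V=F_{N+1}V=0$.
   Context: Let $q$ be a prime power and $N\ge 1$ an integer. Let $\mathbb V$ be an $N$-dimensional vector space over $\mathrm{GF}(q)$, and let $X$ be the set of all subspaces of $\mathbb V$ (including the zero subspace $\mathbf 0$ and $\mathbb V$). For $y,z\in X$, say $z$ covers $y$ if $y\subseteq z$ and $\dim z-\dim y=1$. Let $V=\mathbb R^X$ be the real vector space of column vectors indexed by $X$, with standard basis $\{\hat y\}_{y\in X}$; matrices in $\mathrm{Mat}_X(\mathbb R)$ (real matrices with rows and columns indexed by $X$) act on $V$ by left multiplication. Define $A\in\mathrm{Mat}_X(\mathbb R)$ by $A_{y,z}=1$ if $y$ covers $z$, $A_{y,z}=q^{\dim y}$ if $z$ covers $y$, and $A_{y,z}=0$ otherwise. It is known that $A$ is diagonalizable over $\mathbb R$ with $N+1$ distinct eigenvalues; its primitive idempotents are the projections onto its eigenspaces along the other eigenspaces, and for a primitive idempotent $F$, $FV$ is the corresponding eigenspace. For $0\le i\le N$ let $E^*_i$ be the diagonal matrix with $(y,y)$-entry $1$ if $\dim y=i$ and $0$ otherwise. Let $M^*$ be the subalgebra of $\mathrm{Mat}_X(\mathbb R)$ with basis $E^*_0,\dots,E^*_N$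 (the diagonal matrices whose $(y,y)$-entry depends only on $\dim y$). *)

theory Defs
  imports "HOL-Analysis.Analysis" "HOL-Library.Set_Algebras"
begin

text \<open>
  The index set of the matrices, the set of all subspaces of a vector space over a finite field,
  is represented by a finite type \<^typ>\<open>'x\<close> together with a bijection \<open>X\<close> from that type onto
  the set of subspaces.  Column vectors are then of type \<open>real ^ 'x\<close>, square matrices
  of type \<open>real ^ 'x ^ 'x\<close>, and the row or column labelled by the subspace \<open>X y\<close> has index \<open>y\<close>.
\<close>

definition covers :: "('k::field \<Rightarrow> 'v::ab_group_add \<Rightarrow> 'v) \<Rightarrow> 'v set \<Rightarrow> 'v set \<Rightarrow> bool" where
  "covers smul z y \<longleftrightarrow>
     y \<subseteq> z \<and> vector_space.dim smul z = vector_space.dim smul y + 1"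

definition weighted_adjacency ::
    "('k::field \<Rightarrow> 'v::ab_group_add \<Rightarrow> 'v) \<Rightarrow> ('x::finite \<Rightarrow> 'v set) \<Rightarrow> real ^ 'x ^ 'x" where
  "weighted_adjacency smul X =
     (\<chi> y z. if covers smul (X y) (X z) then 1
             else if covers smul (X z) (X y) then real CARD('k) ^ vector_space.dim smul (X y)
             else 0)"

definition dual_idempotent ::
    "('k::field \<Rightarrow> 'v::ab_group_add \<Rightarrow> 'v) \<Rightarrow> ('x::finite \<Rightarrow> 'v set) \<Rightarrow> nat \<Rightarrow> real ^ 'x ^ 'x" where
  "dual_idempotent smul X i =
     (\<chi> y z. if y = z \<and> vector_space.dim smul (X y) = i then 1 else 0)"

definition dual_adjacency_algebra ::
    "('k::field \<Rightarrow> 'v::ab_group_add \<Rightarrow> 'v) \<Rightarrow> nat \<Rightarrow> ('x::finite \<Rightarrow> 'v set) \<Rightarrow> (real ^ 'x ^ 'x) set" where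
  "dual_adjacency_algebra smul N X = span (dual_idempotent smul X ` {0..N})"

definition eigenspace :: "real ^ 'x ^ 'x \<Rightarrow> real \<Rightarrow> (real ^ 'x::finite) set" where
  "eigenspace A \<theta> = {v. A *v v = \<theta> *\<^sub>R v}"

definition eigenvalues :: "real ^ 'x ^ 'x \<Rightarrow> real set" where
  "eigenvalues A = {\<theta>. \<exists>v::real ^ 'x::finite. v \<noteq> 0 \<and> A *v v = \<theta> *\<^sub>R v}"

text \<open>
  The projection onto one eigenspace along the (sum of the) others.  An idempotent matrix with the
  prescribed range and kernel exists only if the whole space is the direct sum of the two, which is
  the case for every eigenvalue of a diagonalizable matrix; it is then unique.
\<close>

definition primitive_idempotents :: "real ^ 'x ^ 'x \<Rightarrow> (real ^ 'x ^ 'x::finite) set" where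
  "primitive_idempotents A =
     {F. F ** F = F \<and>
         (\<exists>\<theta>\<in>eigenvalues A.
            range ((*v) F) = eigenspace A \<theta> \<and>
            {v. F *v v = 0} = span (\<Union>\<eta>\<in>eigenvalues A - {\<theta>}. eigenspace A \<eta>))}"

text \<open>Subalgebras are unital, so \<open>generated_algebra B\<close> consists of the polynomials in \<open>B\<close>.\<close>

definition subalgebra :: "(real ^ 'x ^ 'x::finite) set \<Rightarrow> bool" where
  "subalgebra S \<longleftrightarrow> subspace S \<and> mat 1 \<in> S \<and> (\<forall>P\<in>S. \<forall>Q\<in>S. P ** Q \<in> S)"

definition generated_algebra :: "real ^ 'x ^ 'x \<Rightarrow> (real ^ 'x ^ 'x::finite) set" where
  "generated_algebra B = subalgebra hull {B}"

text \<open>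
  The space \<open>F\<^sub>i V\<close>; the index is an integer so that the convention \<open>F\<^sub>-\<^sub>1 V = 0\<close> can be expressed.
\<close>

definition idempotent_space ::
    "nat \<Rightarrow> (nat \<Rightarrow> real ^ 'x ^ 'x) \<Rightarrow> int \<Rightarrow> (real ^ 'x::finite) set" where
  "idempotent_space N F i = (if 0 \<le> i \<and> i \<le> int N then range ((*v) (F (nat i))) else {0})"

end

theory Submission
  imports Defs
begin

text \<open>
  Write \<open>A = R + K L\<close> with \<open>R\<close> raising and \<open>L\<close> lowering the dimension and \<open>K = diag (q ^ dim)\<close>, and put
  \<open>S = K\<^sup>-\<^sup>1\<close>; \<open>S\<close> is the matrix \<open>B\<close> of the theorem.  Counting covers gives
  \<open>L R - R L = (q ^ N S - K) / (q - 1)\<close>.  From this, with \<open>p = 1 / q\<close>,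
  \<open>A\<^sup>2 S - (q + p) A S A + S A\<^sup>2 - \<rho> S\<close> is a multiple of an operator \<open>C\<close> that commutes with \<open>A\<close>.
  With \<open>\<theta>\<^sub>i = (q ^ (N - i) - q ^ i) / (q - 1)\<close> for integers \<open>i\<close>, the relation says that
  \<open>(A - \<theta>\<^sub>i\<^sub>-\<^sub>1) (A - \<theta>\<^sub>i\<^sub>+\<^sub>1) S\<close> maps the \<open>\<theta>\<^sub>i\<close>-eigenspace into itself, hence \<open>S\<close> maps it into the sum of the
  eigenspaces for \<open>i - 1\<close>, \<open>i\<close>, \<open>i + 1\<close>.  The row sums of \<open>A\<close> are all \<open>\<theta>\<^sub>0\<close>, so the indices \<open>-1\<close> and \<open>N + 1\<close>
  contribute nothing.  The sum \<open>U\<close> of the remaining eigenspaces is therefore invariant under \<open>A\<close> and \<open>S\<close>,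
  hence under \<open>R\<close> and under all functions of the dimension.  A vector \<open>v\<close> of dimension \<open>r\<close> killed by \<open>L\<close> is
  a component of the eigenvector \<open>\<Sum>k. q ^ (- r k) / [k]! R\<^sup>k v\<close>, so \<open>U\<close> contains the kernel of \<open>L\<close>.
  The orthogonal complement of \<open>U\<close> is invariant under \<open>L = R\<^sup>T\<close>, which is nilpotent, and meets its kernel
  trivially; so \<open>U\<close> is everything.  All \<open>\<theta>\<^sub>i\<close> with \<open>0 \<le> i \<le> N\<close> occur, because a product of \<open>N\<close> factors
  \<open>A - t\<close> applied to the zero subspace has a positive entry in dimension \<open>N\<close>.
\<close>

section \<open>Linear algebra preliminaries: interpolation, polynomials in an operator, spectral
  projections\<close>

text \<open>The closure rules put every polynomial in \<open>s\<close> into \<open>G\<close>, in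
  particular the Lagrange polynomials \<open>l j\<close>; injectivity of \<open>s\<close> makes
  their denominators nonzero. It serves twice: for operators that preserve a subspace and for the
  algebra generated by one diagonal matrix.\<close>

lemma interpolation_closure:
  fixes G :: "(nat \<Rightarrow> real) set" and s f :: "nat \<Rightarrow> real"
  assumes inj: "inj_on s {..N}"
    and one: "(\<lambda>_. 1) \<in> G"
    and add: "\<And>f g. f \<in> G \<Longrightarrow> g \<in> G \<Longrightarrow> (\<lambda>n. f n + g n) \<in> G"
    and scale: "\<And>c f. f \<in> G \<Longrightarrow> (\<lambda>n. c * f n) \<in> G"
    and mult: "\<And>f. f \<in> G \<Longrightarrow> (\<lambda>n. s n * f n) \<in> G"
  shows "\<exists>g\<in>G. \<forall>n\<le>N. g n = f n"
proof -
  have prod: "(\<lambda>n. \<Prod>j\<in>J. (s n - s j)) \<in> G" if "finite J" for J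
    using that
  proof (induction J)
    case empty
    then show ?case using one by simp
  next
    case (insert i J)
    have "(\<lambda>n. s n * (\<Prod>j\<in>J. (s n - s j)) + (- s i) * (\<Prod>j\<in>J. (s n - s j))) \<in> G"
      by (intro add scale mult insert.IH)
    then show ?case
      using insert.hyps by (simp add: algebra_simps)
  qed
  define l where "l j n = (\<Prod>i\<in>{..N} - {j}. (s n - s i))" for j n
  have l0: "l j n = 0" if "n \<le> N" "n \<noteq> j" for j n
    unfolding l_def using that by (intro prod_zero) auto
  have l1: "l j j \<noteq> 0" if "j \<le> N" for j
    unfolding l_def using that inj by (auto simp: inj_on_def)
  have sumG: "(\<lambda>n. \<Sum>j\<in>J. f j / l j j * l j n) \<in> G" if "finite J" for J
    using that
  proof (induction J)
    case empty
    show ?case using scale[OF one, of 0] by simp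
  next
    case (insert i J)
    have "(\<lambda>n. f i / l i i * l i n + (\<Sum>j\<in>J. f j / l j j * l j n)) \<in> G"
      using insert.IH prod[of "{..N} - {i}"] unfolding l_def by (intro add scale) auto
    then show ?case using insert.hyps by simp
  qed
  have "(\<Sum>j\<in>{..N}. f j / l j j * l j n) = f n" if "n \<le> N" for n
  proof -
    have "(\<Sum>j\<in>{..N}. f j / l j j * l j n) = (\<Sum>j\<in>{..N}. if j = n then f n else 0)"
      using that l0 l1 by (intro sum.cong) auto
    then show ?thesis using that by simp
  qed
  then show ?thesis
    by (intro bexI[OF _ sumG[of "{..N}"]]) simp_all
qed

text \<open>The hypothesis says \<open>(A - s) (A - t) x = 0\<close>. The partial fraction identity
  \<open>1 = ((A - t) - (A - s)) / (s - t)\<close> splits \<open>x\<close> into a part killed by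
  \<open>A - s\<close> and one killed by \<open>A - t\<close>.\<close>

lemma quadratic_eigen_decomposition:
  fixes A :: "'a::real_vector \<Rightarrow> 'a"
  assumes "linear A" and st: "s \<noteq> t"
    and root: "A (A x) = (s + t) *\<^sub>R A x - (s * t) *\<^sub>R x"
  obtains a b where "x = a + b" "A a = s *\<^sub>R a" "A b = t *\<^sub>R b"
proof
  interpret linear A by fact
  let ?a = "(1 / (s - t)) *\<^sub>R (A x - t *\<^sub>R x)"
  let ?b = "(1 / (s - t)) *\<^sub>R (s *\<^sub>R x - A x)"
  have "?a + ?b = (1 / (s - t)) *\<^sub>R ((s - t) *\<^sub>R x)"
    by (simp only: scaleR_add_right[symmetric]) (simp add: algebra_simps)
  then show "x = ?a + ?b" using st by simp
  show "A ?a = s *\<^sub>R ?a" "A ?b = t *\<^sub>R ?b"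
    by (simp_all add: scale diff root algebra_simps)
qed

lemma subalgebra_generated:
  fixes B :: "real ^ 'x ^ 'x::finite"
  shows "subalgebra (generated_algebra B)"
proof -
  have Inter: "subalgebra (\<Inter>\<T>)" if "\<forall>T\<in>\<T>. subalgebra T" for \<T> :: "(real ^ 'x ^ 'x) set set"
    using that unfolding subalgebra_def by (intro conjI subspace_Inter) auto
  show ?thesis unfolding generated_algebra_def by (rule hull_in) (rule Inter)
qed

text \<open>The polynomial in \<open>T\<close> with roots \<open>ts\<close>, applied to
  \<open>v\<close>. Keeping the roots in a list lets inductions add one linear factor at a
  time.\<close>

definition factor_product :: "('a::real_vector \<Rightarrow> 'a) \<Rightarrow> real list \<Rightarrow> 'a \<Rightarrow> 'a" where
  "factor_product T ts v = foldr (\<lambda>t v. T v - t *\<^sub>R v) ts v"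

lemma factor_product_simps [simp]:
  "factor_product T [] v = v"
  "factor_product T (t # ts) v = T (factor_product T ts v) - t *\<^sub>R factor_product T ts v"
  by (simp_all add: factor_product_def)

lemma linear_factor_product: "linear T \<Longrightarrow> linear (factor_product T ts)"
proof (induction ts)
  case Nil
  then show ?case by (intro linearI) auto
next
  case (Cons t ts)
  then show ?case
    by (intro linearI) (simp_all add: linear_add linear_scale algebra_simps)
qed

lemma factor_product_eigen:
  "linear T \<Longrightarrow> T v = s *\<^sub>R v \<Longrightarrow> factor_product T ts v = (\<Prod>t\<leftarrow>ts. s - t) *\<^sub>R v"
  by (induction ts) (simp_all add: linear_scale algebra_simps)

text \<open>\<open>F i\<close> is a Lagrange polynomial evaluated at \<open>M\<close>: its roots are
  the \<theta> j with j different from i, and division by its value \<open>c i (\<theta> i)\<close>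
  makes it the identity on the eigenspace of \<theta> i. Since the eigenspaces span, the
  \<open>F i\<close> sum to the identity, and no further eigenvalue can exist.\<close>

lemma primitive_idempotents_of_eigenspaces:
  fixes M :: "real ^ 'x ^ 'x::finite" and \<theta> :: "nat \<Rightarrow> real"
  assumes inj: "inj_on \<theta> {0..N}"
    and nz: "\<And>i. i \<le> N \<Longrightarrow> \<exists>v\<in>eigenspace M (\<theta> i). v \<noteq> 0"
    and total: "span (\<Union>i\<in>{0..N}. eigenspace M (\<theta> i)) = UNIV"
  obtains F where "bij_betw F {0..N} (primitive_idempotents M)"
    and "\<And>i. i \<le> N \<Longrightarrow> range ((*v) (F i)) = eigenspace M (\<theta> i)"
proof -
  have linM: "linear ((*v) M)" by (rule matrix_vector_mul_linear)
  define ts where "ts i = map \<theta> (filter (\<lambda>j. j \<noteq> i) [0..<Suc N])" for i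
  define c where "c i s = (\<Prod>t\<leftarrow>ts i. s - t)" for i s
  define F where "F i = matrix (\<lambda>v. (1 / c i (\<theta> i)) *\<^sub>R factor_product ((*v) M) (ts i) v)" for i
  have F: "F i *v v = (1 / c i (\<theta> i)) *\<^sub>R factor_product ((*v) M) (ts i) v" for i v
  proof -
    have "linear (\<lambda>v. (1 / c i (\<theta> i)) *\<^sub>R factor_product ((*v) M) (ts i) v)"
      using linear_factor_product[OF linM] by (rule linear_compose_scale_right)
    then show ?thesis unfolding F_def by (metis matrix_vector_mul)
  qed
  have F_ev: "F i *v v = (c i s / c i (\<theta> i)) *\<^sub>R v" if "M *v v = s *\<^sub>R v" for i v s
    using factor_product_eigen[OF linM that, of "ts i"] by (simp add: F c_def)
  have c_nz: "c i (\<theta> i) \<noteq> 0" if "i \<le> N" for i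
    using that inj by (auto simp: c_def ts_def prod_list_zero_iff inj_on_def)
  have c_z: "c i (\<theta> j) = 0" if "j \<le> N" "j \<noteq> i" for i j
  proof -
    have "\<theta> j \<in> set (ts i)" using that by (auto simp: ts_def simp del: upt_Suc)
    then show ?thesis by (force simp: c_def prod_list_zero_iff)
  qed
  have F_same: "F i *v v = v" if "i \<le> N" "v \<in> eigenspace M (\<theta> i)" for i v
    using that F_ev[of v "\<theta> i" i] c_nz by (simp add: eigenspace_def)
  have F_other: "F i *v v = 0" if "j \<le> N" "j \<noteq> i" "v \<in> eigenspace M (\<theta> j)" for i j v
    using that F_ev[of v "\<theta> j" i] c_z by (simp add: eigenspace_def)
  have sub_E: "subspace (eigenspace M s)" for s
    by (auto simp: subspace_def eigenspace_def matrix_vector_right_distrib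
        matrix_vector_mult_scaleR algebra_simps)
  have F_in: "F i *v v \<in> eigenspace M (\<theta> i)" if "i \<le> N" for i v
  proof -
    have "v \<in> span (\<Union>i\<in>{0..N}. eigenspace M (\<theta> i))" by (simp add: total)
    then show ?thesis
    proof (induction rule: span_induct_alt)
      case base
      then show ?case by (simp add: subspace_0[OF sub_E])
    next
      case (step a x y)
      then obtain j where j: "j \<le> N" "x \<in> eigenspace M (\<theta> j)" by auto
      have "F i *v x \<in> eigenspace M (\<theta> i)"
        using j F_same[OF that] F_other[of j i x] subspace_0[OF sub_E] by (cases "j = i") auto
      then show ?case using step
        by (simp add: matrix_vector_right_distrib matrix_vector_mult_scaleR
            subspace_add[OF sub_E] subspace_scale[OF sub_E])
    qed
  qed
  have decomp: "v = (\<Sum>i\<in>{0..N}. F i *v v)" for v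
  proof -
    have "v \<in> span (\<Union>i\<in>{0..N}. eigenspace M (\<theta> i))" by (simp add: total)
    then show ?thesis
    proof (induction rule: span_induct_alt)
      case base
      then show ?case by simp
    next
      case (step a x y)
      then obtain j where j: "j \<le> N" "x \<in> eigenspace M (\<theta> j)" by auto
      have "(\<Sum>i\<in>{0..N}. F i *v x) = (\<Sum>i\<in>{0..N}. if i = j then x else 0)"
        using j F_same F_other by (intro sum.cong) auto
      also have "\<dots> = x" using j by simp
      finally have "(\<Sum>i\<in>{0..N}. F i *v x) = x" .
      then show ?case using step(2)
        by (simp add: matrix_vector_right_distrib matrix_vector_mult_scaleR sum.distrib
            scaleR_sum_right[symmetric])
    qed
  qed
  have ev: "eigenvalues M = \<theta> ` {0..N}"
  proof (intro equalityI subsetI)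
    fix s assume "s \<in> eigenvalues M"
    then obtain v where v: "v \<noteq> 0" "M *v v = s *\<^sub>R v" by (auto simp: eigenvalues_def)
    obtain i where i: "i \<le> N" "F i *v v \<noteq> 0"
      using v decomp[of v] by (metis atLeastAtMost_iff sum.neutral)
    have "M *v (F i *v v) = s *\<^sub>R (F i *v v)"
      using F_ev[OF v(2), of i] v(2) by (simp add: matrix_vector_mult_scaleR)
    moreover have "M *v (F i *v v) = \<theta> i *\<^sub>R (F i *v v)"
      using F_in[OF i(1), of v] by (simp add: eigenspace_def)
    ultimately have "s = \<theta> i" using i(2) by (metis scaleR_right_imp_eq)
    then show "s \<in> \<theta> ` {0..N}" using i by auto
  next
    fix s assume "s \<in> \<theta> ` {0..N}"
    then show "s \<in> eigenvalues M" using nz by (fastforce simp: eigenvalues_def eigenspace_def)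
  qed
  have others: "(\<Union>\<eta>\<in>eigenvalues M - {\<theta> i}. eigenspace M \<eta>)
      = (\<Union>j\<in>{0..N} - {i}. eigenspace M (\<theta> j))" if "i \<le> N" for i
    using that inj unfolding ev by (auto simp: inj_on_def) 
  have range_F: "range ((*v) (F i)) = eigenspace M (\<theta> i)" if "i \<le> N" for i
    using F_in[OF that] F_same[OF that] by (auto simp: image_iff) metis
  have ker_F: "{v. F i *v v = 0} = span (\<Union>j\<in>{0..N} - {i}. eigenspace M (\<theta> j))" (is "?l = ?r")
    if i: "i \<le> N" for i
  proof (intro equalityI subsetI)
    fix v assume "v \<in> ?l"
    then have "v = (\<Sum>j\<in>{0..N} - {i}. F j *v v)"
      using decomp[of v] i by (simp add: sum.remove[of "{0..N}" i])
    moreover have "(\<Sum>j\<in>{0..N} - {i}. F j *v v) \<in> ?r"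
    proof (rule span_sum)
      fix j assume "j \<in> {0..N} - {i}"
      then show "F j *v v \<in> ?r" using F_in[of j v] by (intro span_base UN_I[of j]) auto
    qed
    ultimately show "v \<in> ?r" by simp
  next
    fix v assume "v \<in> ?r"
    then show "v \<in> ?l"
    proof (induction rule: span_induct_alt)
      case (step a x y)
      then obtain j where "j \<in> {0..N} - {i}" "x \<in> eigenspace M (\<theta> j)" by blast
      then have "F i *v x = 0" using F_other[of j i x] by simp
      then show ?case using step
        by (simp add: matrix_vector_right_distrib matrix_vector_mult_scaleR)
    qed simp
  qed
  have "F i \<in> primitive_idempotents M" if "i \<le> N" for i
  proof -
    have "F i ** F i = F i"
      using F_same[OF that F_in[OF that]]
      by (simp add: matrix_eq matrix_vector_mul_assoc[symmetric])
    then show ?thesis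
      unfolding primitive_idempotents_def using range_F[OF that] ker_F[OF that] others[OF that] that ev
      by (auto intro!: bexI[of _ "\<theta> i"])
  qed
  \<comment> \<open>A projection is determined by its range and kernel: \<open>G\<close> fixes the
    component \<open>F i v\<close> of a vector \<open>v\<close> and kills the other components
    \<open>F j v\<close>.\<close>
  moreover have "G \<in> F ` {0..N}" if G: "G \<in> primitive_idempotents M" for G
  proof -
    obtain i where i: "i \<le> N" and GG: "G ** G = G" and ran: "range ((*v) G) = eigenspace M (\<theta> i)"
      and ker: "{v. G *v v = 0} = span (\<Union>j\<in>{0..N} - {i}. eigenspace M (\<theta> j))"
      using G others by (auto simp: primitive_idempotents_def ev)
    have "G *v v = F i *v v" for v
    proof -
      have "G *v (F j *v v) = (if j = i then F i *v v else 0)" if "j \<le> N" for j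
      proof (cases "j = i")
        case True
        obtain w where "F i *v v = G *v w" using F_in[OF i, of v] ran by (metis imageE)
        then show ?thesis using True GG by (simp add: matrix_vector_mul_assoc)
      next
        case False
        then have "F j *v v \<in> {v. G *v v = 0}"
          unfolding ker using F_in[OF that, of v] that by (intro span_base UN_I[of j]) auto
        then show ?thesis using False by simp
      qed
      then have "(\<Sum>j\<in>{0..N}. G *v (F j *v v)) = F i *v v"
        using i by simp
      moreover have "G *v v = (\<Sum>j\<in>{0..N}. G *v (F j *v v))"
        by (subst decomp[of v]) (rule linear_sum[OF matrix_vector_mul_linear])
      ultimately show ?thesis by simp
    qed
    then show ?thesis using i by (auto simp: matrix_eq intro!: image_eqI[of _ _ i])
  qed
  moreover have "inj_on F {0..N}"
  proof (rule inj_onI)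
    fix i j assume ij: "i \<in> {0..N}" "j \<in> {0..N}" "F i = F j"
    then have "eigenspace M (\<theta> i) = eigenspace M (\<theta> j)"
      using range_F[of i] range_F[of j] by simp
    moreover obtain v where "v \<noteq> 0" "v \<in> eigenspace M (\<theta> i)"
      using nz[of i] ij by auto
    ultimately have "v \<in> eigenspace M (\<theta> i)" "v \<in> eigenspace M (\<theta> j)" by simp_all
    then have "M *v v = \<theta> i *\<^sub>R v" and "M *v v = \<theta> j *\<^sub>R v"
      unfolding eigenspace_def by (simp_all only: mem_Collect_eq)
    then have "\<theta> i *\<^sub>R v = \<theta> j *\<^sub>R v" by (rule trans[OF sym])
    then show "i = j" using ij inj \<open>v \<noteq> 0\<close> by (simp add: inj_on_def)
  qed
  ultimately have "bij_betw F {0..N} (primitive_idempotents M)"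
    by (auto simp: bij_betw_def)
  then show ?thesis using that range_F by blast
qed

text \<open>
  The part of the subspace lattice that matters: a ranking \<open>d\<close>, the cover relation \<open>cov y z\<close>
  (\<open>y\<close> covers \<open>z\<close>), the numbers of upper and lower covers, and the fact that two distinct elements
  of equal rank have as many common upper as common lower covers.
\<close>

locale q_graded =
  fixes q :: real and N :: nat and d :: "'x::finite \<Rightarrow> nat" and cov :: "'x \<Rightarrow> 'x \<Rightarrow> bool"
  assumes q_gt1: "q > 1"
    and d_le: "d y \<le> N"
    and cov_d: "cov y z \<Longrightarrow> d y = Suc (d z)"
    and card_up: "real (card {z. cov z y}) = (q ^ N / q ^ d y - 1) / (q - 1)"
    and card_down: "real (card {z. cov y z}) = (q ^ d y - 1) / (q - 1)"
    and card_common: "y \<noteq> w \<Longrightarrow> d y = d w \<Longrightarrow>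
        card {z. cov z y \<and> cov z w} = card {z. cov y z \<and> cov w z}"
    and ex_bottom: "\<exists>y. d y = 0"
begin

section \<open>Raising, lowering and diagonal operators and their commutation rules\<close>

definition R :: "real ^ 'x \<Rightarrow> real ^ 'x" where
  "R v = (\<chi> y. \<Sum>z\<in>UNIV. if cov y z then v $ z else 0)"

definition L :: "real ^ 'x \<Rightarrow> real ^ 'x" where
  "L v = (\<chi> y. \<Sum>z\<in>UNIV. if cov z y then v $ z else 0)"

definition D :: "(nat \<Rightarrow> real) \<Rightarrow> real ^ 'x \<Rightarrow> real ^ 'x" where
  "D f v = (\<chi> y. f (d y) * v $ y)"

definition K :: "real ^ 'x \<Rightarrow> real ^ 'x" where "K = D (\<lambda>n. q ^ n)"

definition S :: "real ^ 'x \<Rightarrow> real ^ 'x" where "S = D (\<lambda>n. 1 / q ^ n)"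

definition A :: "real ^ 'x \<Rightarrow> real ^ 'x" where "A v = R v + K (L v)"

text \<open>The two reciprocals get names so that later scalar identities become polynomial
  consequences of \<open>q_e\<close> and \<open>q_p\<close>, within reach of
  \<open>algebra\<close>.\<close>

definition e :: real where "e = 1 / (q - 1)"

definition p :: real where "p = 1 / q"

lemma q_e: "q * e = 1 + e" and q_p: "q * p = 1"
  using q_gt1 by (simp_all add: e_def p_def field_simps)

lemma q_pos: "q > 0" "q \<noteq> 0" "q \<noteq> 1" "q - 1 \<noteq> 0"
  using q_gt1 by auto

lemma linear_R: "linear R"
  by (rule linearI) (auto simp: R_def vec_eq_iff sum.distrib[symmetric] sum_distrib_left
      intro!: sum.cong)

lemma linear_L: "linear L"
  by (rule linearI) (auto simp: L_def vec_eq_iff sum.distrib[symmetric] sum_distrib_left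
      intro!: sum.cong)

lemma linear_D: "linear (D f)"
  by (rule linearI) (auto simp: D_def vec_eq_iff algebra_simps)

lemma linear_K: "linear K" and linear_S: "linear S"
  by (simp_all add: K_def S_def linear_D)

lemma linear_A: "linear A"
  unfolding A_def
  using linear_R linear_compose[OF linear_L linear_K] linear_compose_add by (auto simp: o_def)

lemmas op_linear =
  linear_add[OF linear_R] linear_add[OF linear_L] linear_add[OF linear_K]
  linear_add[OF linear_S] linear_add[OF linear_A] linear_add[OF linear_D]
  linear_diff[OF linear_R] linear_diff[OF linear_L] linear_diff[OF linear_K]
  linear_diff[OF linear_S] linear_diff[OF linear_A] linear_diff[OF linear_D]
  linear_scale[OF linear_R] linear_scale[OF linear_L] linear_scale[OF linear_K]
  linear_scale[OF linear_S] linear_scale[OF linear_A] linear_scale[OF linear_D]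
  linear_0[OF linear_R] linear_0[OF linear_L] linear_0[OF linear_K]
  linear_0[OF linear_S] linear_0[OF linear_A] linear_0[OF linear_D]

lemma D_D: "D f (D g v) = D (\<lambda>n. f n * g n) v"
  by (simp add: D_def vec_eq_iff)

lemma D_cong: "(\<And>n. n \<le> N \<Longrightarrow> f n = g n) \<Longrightarrow> D f = D g"
  using d_le by (auto simp: D_def vec_eq_iff fun_eq_iff)

lemma D_R: "D f (R v) = R (D (\<lambda>n. f (Suc n)) v)"
  using cov_d by (auto simp: D_def R_def vec_eq_iff sum_distrib_left intro!: sum.cong)

lemma L_D: "L (D f v) = D (\<lambda>n. f (Suc n)) (L v)"
  using cov_d by (auto simp: D_def L_def vec_eq_iff sum_distrib_left intro!: sum.cong)

lemma K_S [simp]: "K (S v) = v" and S_K [simp]: "S (K v) = v"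
  using q_pos by (auto simp: K_def S_def D_def vec_eq_iff)

lemma scale_D: "c *\<^sub>R D f v = D (\<lambda>n. c * f n) v"
  by (simp add: D_def vec_eq_iff)

lemma K_R: "K (R v) = q *\<^sub>R R (K v)"
  \<comment> \<open>\<open>op_linear(13)\<close> is the scaling rule for \<open>R\<close>.\<close>
  unfolding K_def D_R by (simp add: scale_D op_linear(13)[symmetric])

lemma S_R: "S (R v) = p *\<^sub>R R (S v)"
  unfolding S_def p_def D_R by (simp add: scale_D op_linear(13)[symmetric])

lemma L_K: "L (K v) = q *\<^sub>R K (L v)"
  unfolding K_def L_D by (simp add: scale_D)

lemma L_S: "L (S v) = p *\<^sub>R S (L v)"
  unfolding S_def p_def L_D by (simp add: scale_D)

text \<open>The coefficient of \<open>v $ w\<close> in row \<open>y\<close> of the commutator is the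
  number of common upper covers minus the number of common lower covers of \<open>y\<close> and
  \<open>w\<close>. For distinct \<open>y\<close> and \<open>w\<close> it vanishes, by
  \<open>card_common\<close> for equal ranks and because both sets are empty for different ranks.
  Only the diagonal terms, given by \<open>card_up\<close> and \<open>card_down\<close>,
  survive.\<close>

lemma L_R: "L (R v) = R (L v) + e *\<^sub>R (q ^ N *\<^sub>R S v - K v)"
proof -
  have sw: "(\<Sum>z\<in>UNIV. if P z then (\<Sum>w\<in>UNIV. if Q z w then v $ w else 0) else 0) =
      (\<Sum>w\<in>UNIV. real (card {z. P z \<and> Q z w}) * v $ w)" for P :: "'x \<Rightarrow> bool" and Q
  proof -
    have "(\<Sum>z\<in>UNIV. if P z then (\<Sum>w\<in>UNIV. if Q z w then v $ w else 0) else 0) =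
      (\<Sum>z\<in>UNIV. \<Sum>w\<in>UNIV. if P z \<and> Q z w then v $ w else 0)"
      by (intro sum.cong) auto
    also have "\<dots> = (\<Sum>w\<in>UNIV. \<Sum>z\<in>UNIV. if P z \<and> Q z w then v $ w else 0)"
      by (rule sum.swap)
    also have "\<dots> = (\<Sum>w\<in>UNIV. real (card {z. P z \<and> Q z w}) * v $ w)"
      by (intro sum.cong) (auto simp: sum.If_cases)
    finally show ?thesis .
  qed
  have off: "card {z. cov z y \<and> cov z w} = card {z. cov y z \<and> cov w z}" if "y \<noteq> w" for y w
  proof (cases "d y = d w")
    case False
    have "{z. cov z y \<and> cov z w} = {}"
      using False by (auto dest!: cov_d)
    moreover have "{z. cov y z \<and> cov w z} = {}"
      using False by (auto dest!: cov_d)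
    ultimately show ?thesis by (simp only:)
  qed (use that card_common in blast)
  have "L (R v) $ y - R (L v) $ y = (q ^ N / q ^ d y - q ^ d y) / (q - 1) * v $ y" for y
  proof -
    have "L (R v) $ y - R (L v) $ y =
       (\<Sum>w\<in>UNIV. (real (card {z. cov z y \<and> cov z w}) - real (card {z. cov y z \<and> cov w z})) * v $ w)"
    proof -
      have "L (R v) $ y = (\<Sum>w\<in>UNIV. real (card {z. cov z y \<and> cov z w}) * v $ w)"
        by (simp only: L_def R_def vec_lambda_beta sw)
      moreover have "R (L v) $ y = (\<Sum>w\<in>UNIV. real (card {z. cov y z \<and> cov w z}) * v $ w)"
        by (simp only: L_def R_def vec_lambda_beta sw)
      ultimately show ?thesis by (simp only: sum_subtractf left_diff_distrib)
    qed
    also have "\<dots> = (\<Sum>w\<in>UNIV. if w = y then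
        (real (card {z. cov z y}) - real (card {z. cov y z})) * v $ y else 0)"
      using off by (intro sum.cong) auto
    also have "\<dots> = (real (card {z. cov z y}) - real (card {z. cov y z})) * v $ y"
      by simp
    finally show ?thesis by (simp add: card_up card_down diff_divide_distrib)
  qed
  then show ?thesis
    by (simp add: vec_eq_iff S_def K_def D_def e_def diff_divide_distrib algebra_simps)
qed

text \<open>A Casimir-type element: the diagonal correction absorbs the commutator of
  \<open>L\<close> and \<open>R\<close>, so that the operator commutes with \<open>R\<close>,
  \<open>L\<close> and \<open>K\<close>, hence with \<open>A\<close>.\<close>

definition C :: "real ^ 'x \<Rightarrow> real ^ 'x" where
  "C v = R (L v) + (e * e) *\<^sub>R (K v + (q * q ^ N) *\<^sub>R S v)"

lemma C_R: "C (R v) = R (C v)"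
proof -
  \<comment> \<open>The identity is read at one coordinate, with \<open>m\<close>, \<open>s\<close>,
    \<open>k\<close> standing for \<open>q ^ N\<close> and the entries of \<open>R (S v)\<close> and
    \<open>R (K v)\<close>.\<close>
  have "e * (m * s - k) + e * e * (q * k + q * m * (p * s)) = e * e * (k + q * m * s)" for m s k
    using q_e q_p by algebra
  from this[of "q ^ N" "R (S v) $ i" "R (K v) $ i" for i] show ?thesis
    by (simp add: C_def L_R K_R S_R op_linear vec_eq_iff algebra_simps)
qed

lemma S_L: "S (L v) = q *\<^sub>R L (S v)" and K_L: "K (L v) = p *\<^sub>R L (K v)"
  using q_p by (simp_all add: L_S L_K mult.commute)

lemma C_L: "C (L v) = L (C v)"
proof -
  have "e * e * (k + q * m * s) = e * (m * s - k) + e * e * (q * k + q * m * (p * s))" for m s k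
    using q_e q_p by algebra
  note eq = this[of "K (L v) $ i" "q ^ N" "S (L v) $ i" for i]
  have "L (C v) = L (R (L v)) + (e * e) *\<^sub>R (L (K v) + (q * q ^ N) *\<^sub>R L (S v))"
    by (simp add: C_def op_linear)
  also have "\<dots> = R (L (L v)) + e *\<^sub>R (q ^ N *\<^sub>R S (L v) - K (L v))
      + (e * e) *\<^sub>R (q *\<^sub>R K (L v) + (q * q ^ N) *\<^sub>R p *\<^sub>R S (L v))"
    by (simp add: L_R L_K L_S)
  finally have LC: "L (C v) = \<dots>" .
  have "C (L v) $ i = L (C v) $ i" for i
    using eq[of i] unfolding LC by (simp add: C_def[of "L v"] algebra_simps)
  then show ?thesis by (simp add: vec_eq_iff)
qed

lemma C_K: "C (K v) = K (C v)"
proof -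
  have "K (R (L v)) = R (L (K v))"
    using q_p by (simp add: K_R K_L op_linear)
  then show ?thesis
    by (simp add: C_def op_linear)
qed

lemma C_add: "C (v + w) = C v + C w"
  by (simp add: C_def op_linear algebra_simps)

lemma C_scale: "C (c *\<^sub>R v) = c *\<^sub>R C v"
  by (simp add: C_def op_linear algebra_simps)

lemma C_A: "C (A v) = A (C v)"
  by (simp add: A_def C_add C_R C_L C_K)

section \<open>The cubic relation and the action of \<open>S\<close> on eigenspaces\<close>

definition \<rho> :: real where "\<rho> = q ^ N * p * p * (q + 1)\<^sup>2"

text \<open>Moving \<open>S\<close> from the right to the left of a word multiplies it by
  \<open>p\<close> for each \<open>R\<close> and by \<open>q\<close> for each \<open>K L\<close>.
  Both \<open>p\<close> and \<open>q\<close> are roots of \<open>x * x - (q + p) * x + 1\<close>, so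
  all terms that change the rank by two cancel. The rewriting brings the rest to the order raising,
  lowering, diagonal, where the coefficients can be compared.\<close>

lemma tridiagonal_relation:
  "A (A (S v)) - (q + p) *\<^sub>R A (S (A v)) + S (A (A v)) - \<rho> *\<^sub>R S v
    = ((p - q) * (1 - p)) *\<^sub>R C v"
proof -
  define m where "m = q ^ N"
  show ?thesis
    unfolding A_def C_def \<rho>_def m_def[symmetric]
    by (simp only: op_linear K_R S_R S_L K_L L_R[folded m_def] K_S S_K
        scaleR_add_right scaleR_diff_right scaleR_scaleR, simp add: vec_eq_iff)
      (use q_e q_p in algebra)
qed

text \<open>The candidate eigenvalue \<theta> of index i is the value at \<open>u = q ^ i\<close>;
  passing to a neighbouring index multiplies \<open>u\<close> by \<open>p\<close> or
  \<open>q\<close>.\<close>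

definition th :: "real \<Rightarrow> real" where "th u = (q ^ N / u - u) * e"

definition E :: "real \<Rightarrow> (real ^ 'x) set" where "E t = {v. A v = t *\<^sub>R v}"

lemma subspace_E: "subspace (E t)"
  by (auto simp: subspace_def E_def op_linear algebra_simps)

lemma th_strict_antimono: "0 < u \<Longrightarrow> u < w \<Longrightarrow> th w < th u"
proof -
  assume "0 < u" "u < w"
  then have "q ^ N / w < q ^ N / u" using q_pos by (simp add: frac_less2)
  then show ?thesis using q_gt1 \<open>u < w\<close> by (simp add: th_def e_def divide_strict_right_mono)
qed

text \<open>Sum and product of the two neighbours of \<open>th u\<close> are the coefficients of the
  quadratic in \<open>A\<close> that \<open>tridiagonal_relation\<close> yields on the
  \<open>th u\<close>-eigenspace, so the neighbours are its roots.\<close>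

lemma th_step:
  assumes "u > 0"
  shows "th (p * u) + th (q * u) = (q + p) * th u"
    and "th (p * u) * th (q * u) = (th u)\<^sup>2 - \<rho>"
proof -
  define w where "w = 1 / u"
  have w: "u * w = 1" using assms by (simp add: w_def)
  have th: "th (p * u) = (q ^ N * (q * w) - p * u) * e" "th (q * u) = (q ^ N * (p * w) - q * u) * e"
    "th u = (q ^ N * w - u) * e"
    using assms q_gt1 by (simp_all add: th_def w_def p_def)
  define m where "m = q ^ N"
  show "th (p * u) + th (q * u) = (q + p) * th u"
    unfolding th by algebra
  show "th (p * u) * th (q * u) = (th u)\<^sup>2 - \<rho>"
    unfolding th \<rho>_def m_def[symmetric] using w q_e q_p by algebra
qed

lemma S_E:
  assumes "u > 0" "v \<in> E (th u)"
  shows "\<exists>a\<in>E (th (p * u)). \<exists>b\<in>E (th u). \<exists>c\<in>E (th (q * u)). S v = a + b + c"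
proof -
  let ?t = "th u" and ?t1 = "th (p * u)" and ?t2 = "th (q * u)"
  have p: "0 < p" "p < 1" using q_gt1 by (auto simp: p_def)
  have lt: "?t < ?t1" "?t2 < ?t"
    using assms(1) p q_gt1 by (auto intro!: th_strict_antimono)
  have Av: "A v = ?t *\<^sub>R v" using assms by (simp add: E_def)
  define z where "z = ((p - q) * (1 - p)) *\<^sub>R C v"
  have Az: "A z = ?t *\<^sub>R z"
    using C_A[of v] by (simp add: z_def op_linear Av C_scale flip: C_A)
  \<comment> \<open>The factor is chosen so that \<open>(A - ?t1) (A - ?t2)\<close> maps
    \<open>b\<close> to \<open>z\<close>, the value it takes at \<open>S v\<close>. The difference
    \<open>S v - b\<close> is then killed by the quadratic.\<close>
  define b where "b = (1 / ((?t - ?t1) * (?t - ?t2))) *\<^sub>R z"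
  have Ab: "A b = ?t *\<^sub>R b" by (simp add: b_def op_linear Az)
  have zb: "z = ((?t - ?t1) * (?t - ?t2)) *\<^sub>R b" using lt by (simp add: b_def)
  let ?x = "S v - b"
  have "A (A (S v)) = ((q + p) * ?t) *\<^sub>R A (S v) - (?t\<^sup>2 - \<rho>) *\<^sub>R S v + z"
    using tridiagonal_relation[of v] unfolding z_def[symmetric]
    by (simp add: Av op_linear power2_eq_square algebra_simps)
  then have "A (A (S v)) = (?t1 + ?t2) *\<^sub>R A (S v) - (?t1 * ?t2) *\<^sub>R S v + z"
    by (simp only: th_step[OF assms(1)])
  then have "A (A ?x) = (?t1 + ?t2) *\<^sub>R A ?x - (?t1 * ?t2) *\<^sub>R ?x"
    by (simp add: op_linear Ab zb algebra_simps)
  then obtain a c where "?x = a + c" "A a = ?t1 *\<^sub>R a" "A c = ?t2 *\<^sub>R c"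
    using quadratic_eigen_decomposition[OF linear_A] lt by (metis less_irrefl less_trans)
  then have "S v = a + b + c" "a \<in> E ?t1" "b \<in> E ?t" "c \<in> E ?t2"
    using Ab by (simp_all add: E_def algebra_simps)
  then show ?thesis by blast
qed

text \<open>Compare both sides of the eigenvalue equation at an entry of largest absolute value. The
  row sum at \<open>y\<close>, the number of lower covers plus \<open>q ^ d y\<close> times the
  number of upper covers, is \<open>th 1\<close> whatever \<open>y\<close> is.\<close>

lemma eigenvalue_bound:
  assumes "v \<in> E t" "v \<noteq> 0"
  shows "\<bar>t\<bar> \<le> th 1"
proof -
  define m where "m = Max (range (\<lambda>y. \<bar>v $ y\<bar>))"
  have le: "\<bar>v $ y\<bar> \<le> m" for y unfolding m_def by (intro Max_ge) auto
  have "m \<in> range (\<lambda>y. \<bar>v $ y\<bar>)" unfolding m_def by (intro Max_in) auto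
  then obtain y where y: "m = \<bar>v $ y\<bar>" by blast
  have "m > 0"
  proof (rule ccontr)
    assume "\<not> m > 0"
    then have "\<bar>v $ z\<bar> \<le> 0" for z using le[of z] by linarith
    then have "v = 0" by (simp add: vec_eq_iff)
    then show False using assms by simp
  qed
  have cnt: "\<bar>\<Sum>z\<in>UNIV. if P z then v $ z else 0\<bar> \<le> real (card {z. P z}) * m" for P
  proof -
    have "\<bar>\<Sum>z\<in>UNIV. if P z then v $ z else 0\<bar> = \<bar>\<Sum>z\<in>{z. P z}. v $ z\<bar>"
      by (simp add: sum.If_cases)
    also have "\<dots> \<le> (\<Sum>z\<in>{z. P z}. \<bar>v $ z\<bar>)" by (rule sum_abs)
    also have "\<dots> \<le> real (card {z. P z}) * m" using le by (intro sum_bounded_above) auto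
    finally show ?thesis .
  qed
  have "\<bar>t\<bar> * m = \<bar>A v $ y\<bar>" using assms y by (simp add: E_def abs_mult)
  also have "\<dots> \<le> \<bar>R v $ y\<bar> + q ^ d y * \<bar>L v $ y\<bar>"
    using q_pos by (simp add: A_def K_def D_def abs_mult order.trans[OF abs_triangle_ineq])
  also have "\<dots> \<le> real (card {z. cov y z}) * m + q ^ d y * (real (card {z. cov z y}) * m)"
    using q_pos unfolding R_def L_def by (intro add_mono mult_left_mono) (simp_all add: cnt)
  also have "\<dots> = ((q ^ d y - 1) / (q - 1) + q ^ d y * ((q ^ N / q ^ d y - 1) / (q - 1))) * m"
    by (simp add: card_up card_down algebra_simps)
  also have "\<dots> = th 1 * m"
  proof -
    have "q ^ d y * ((q ^ N / q ^ d y - 1) / (q - 1)) = (q ^ N - q ^ d y) / (q - 1)"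
      using q_pos by (simp add: right_diff_distrib)
    then show ?thesis
      unfolding th_def e_def by (simp only: add_divide_distrib[symmetric]) simp
  qed
  finally show ?thesis using \<open>m > 0\<close> by simp
qed

text \<open>Integer indices give the neighbours \<open>-1\<close> and \<open>N + 1\<close> a
  meaning.\<close>

definition theta :: "int \<Rightarrow> real" where "theta i = th (q powi i)"

lemma theta_S_E:
  assumes "v \<in> E (theta i)"
  shows "\<exists>a\<in>E (theta (i - 1)). \<exists>b\<in>E (theta i). \<exists>c\<in>E (theta (i + 1)). S v = a + b + c"
proof -
  have "p * q powi i = q powi (i - 1)" "q * q powi i = q powi (i + 1)"
    using q_pos by (simp_all add: p_def power_int_diff power_int_add)
  then show ?thesis
    using S_E[of "q powi i" v] assms q_pos by (simp add: theta_def)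
qed

lemma theta_strict_antimono: "i < j \<Longrightarrow> theta j < theta i"
  unfolding theta_def using q_gt1
  by (intro th_strict_antimono power_int_strict_increasing) auto

text \<open>Both values exceed the bound \<open>th 1 = theta 0\<close> in absolute value:
  \<open>theta\<close> is strictly decreasing, and \<open>theta (N + 1)\<close> is the negative of
  \<open>theta (-1)\<close>.\<close>

lemma E_outside: "E (theta (-1)) = {0}" "E (theta (int N + 1)) = {0}"
proof -
  have *: "E t = {0}" if "\<bar>t\<bar> > th 1" for t
  proof -
    have "v = 0" if "v \<in> E t" for v
      using eigenvalue_bound[OF that] \<open>\<bar>t\<bar> > th 1\<close> by force
    then show ?thesis using subspace_0[OF subspace_E] by auto
  qed
  have gt: "theta (-1) > th 1"
    using theta_strict_antimono[of "-1" 0] by (simp add: theta_def)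
  then show "E (theta (-1)) = {0}" by (intro *) auto
  have "theta (int N + 1) = - theta (-1)"
    using q_pos by (simp add: theta_def th_def power_int_add power_int_minus field_simps)
  then show "E (theta (int N + 1)) = {0}" using gt by (intro *) auto
qed

section \<open>The span of the eigenspaces and its invariance\<close>

definition U :: "(real ^ 'x) set" where "U = span (\<Union>i\<in>{0..int N}. E (theta i))"

lemma subspace_U: "subspace U"
  by (simp add: U_def)

lemma E_U: "0 \<le> i \<Longrightarrow> i \<le> int N \<Longrightarrow> v \<in> E (theta i) \<Longrightarrow> v \<in> U"
  unfolding U_def by (intro span_base) auto

lemma E_U': "-1 \<le> i \<Longrightarrow> i \<le> int N + 1 \<Longrightarrow> v \<in> E (theta i) \<Longrightarrow> v \<in> U"
  using E_U[of i v] E_outside subspace_0[OF subspace_U]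
  by (cases "i = -1"; cases "i = int N + 1") auto

lemma U_invariant:
  assumes "linear T" and "\<And>i v. 0 \<le> i \<Longrightarrow> i \<le> int N \<Longrightarrow> v \<in> E (theta i) \<Longrightarrow> T v \<in> U"
    and "v \<in> U"
  shows "T v \<in> U"
  using assms(3) unfolding U_def
proof (induction rule: span_induct_alt)
  case base
  then show ?case using linear_0[OF assms(1)] by (simp add: span_zero)
next
  case (step c x y)
  then show ?case
    using assms(2) linear_add[OF assms(1)] linear_scale[OF assms(1)]
    by (auto simp: U_def intro!: span_add span_scale)
qed

lemma A_U: "v \<in> U \<Longrightarrow> A v \<in> U"
  by (rule U_invariant[OF linear_A])
    (auto simp: E_def intro!: subspace_scale[OF subspace_U] E_U)

lemma S_U: "v \<in> U \<Longrightarrow> S v \<in> U"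
proof (rule U_invariant[OF linear_S])
  fix i v assume i: "0 \<le> i" "i \<le> int N" "v \<in> E (theta i)"
  from theta_S_E[OF i(3)] obtain a b c where
    "a \<in> E (theta (i - 1))" "b \<in> E (theta i)" "c \<in> E (theta (i + 1))" "S v = a + b + c" by blast
  moreover from this have "a \<in> U" "b \<in> U" "c \<in> U"
    using i E_U'[of "i - 1" a] E_U'[of i b] E_U'[of "i + 1" c] by auto
  ultimately show "S v \<in> U"
    by (simp add: subspace_add[OF subspace_U])
qed

lemma inj_inverse_power: "inj_on (\<lambda>n. 1 / q ^ n) M"
  using q_gt1 by (auto simp: inj_on_def power_inject_exp)

text \<open>\<open>S\<close> takes different values on different ranks, so by interpolation every
  function of the rank acts as a polynomial in \<open>S\<close>.\<close>

lemma D_U: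
  assumes "v \<in> U"
  shows "D f v \<in> U"
proof -
  have "\<exists>g\<in>{f. \<forall>v\<in>U. D f v \<in> U}. \<forall>n\<le>N. g n = f n"
  proof (rule interpolation_closure[OF inj_inverse_power])
    fix f g :: "nat \<Rightarrow> real" and c
    assume f: "f \<in> {f. \<forall>v\<in>U. D f v \<in> U}"
    have "D (\<lambda>n. c * f n) v = c *\<^sub>R D f v" for v by (simp add: scale_D)
    then show "(\<lambda>n. c * f n) \<in> {f. \<forall>v\<in>U. D f v \<in> U}"
      using f subspace_scale[OF subspace_U] by auto
    have "D (\<lambda>n. 1 / q ^ n * f n) v = S (D f v)" for v by (simp add: S_def D_D)
    then show "(\<lambda>n. 1 / q ^ n * f n) \<in> {f. \<forall>v\<in>U. D f v \<in> U}"
      using f S_U by auto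
    assume g: "g \<in> {f. \<forall>v\<in>U. D f v \<in> U}"
    have "D (\<lambda>n. f n + g n) v = D f v + D g v" for v by (simp add: D_def vec_eq_iff algebra_simps)
    then show "(\<lambda>n. f n + g n) \<in> {f. \<forall>v\<in>U. D f v \<in> U}"
      using f g subspace_add[OF subspace_U] by auto
  qed (simp add: D_def)
  then obtain g where "\<forall>v\<in>U. D g v \<in> U" "\<forall>n\<le>N. g n = f n" by blast
  then show ?thesis using assms D_cong[of g f] by auto
qed

text \<open>Conjugation of \<open>A\<close> by \<open>K\<close> multiplies its raising part by
  \<open>q\<close> and its lowering part by \<open>p\<close>; \<open>q K A S - A\<close> therefore
  isolates the raising part.\<close>

lemma R_U: "v \<in> U \<Longrightarrow> R v \<in> U"
proof -
  assume v: "v \<in> U"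
  have "q *\<^sub>R K (A (S v)) - A v = (q\<^sup>2 - 1) *\<^sub>R R v"
    using q_p by (simp add: A_def op_linear K_R K_L L_S vec_eq_iff power2_eq_square algebra_simps)
  then have "R v = (1 / (q\<^sup>2 - 1)) *\<^sub>R (q *\<^sub>R K (A (S v)) - A v)"
    using q_gt1 by (simp add: power2_eq_1_iff)
  moreover have "q *\<^sub>R K (A (S v)) - A v \<in> U"
    using v by (intro subspace_diff subspace_scale subspace_U A_U) (simp_all add: K_def D_U S_U A_U)
  ultimately show ?thesis using subspace_scale[OF subspace_U] by simp
qed

section \<open>Strings generated from lowest weight vectors\<close>

lemma R_pow_support: "d y < k \<Longrightarrow> (R ^^ k) v $ y = 0"
proof (induction k arbitrary: y)
  case (Suc k)
  have "(R ^^ k) v $ z = 0" if "cov y z" for z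
    using Suc.IH[of z] Suc.prems cov_d[OF that] by simp
  then show ?case by (simp add: R_def[of "(R ^^ k) v"] cong: if_cong)
qed simp

lemma L_pow_support: "N < d y + k \<Longrightarrow> (L ^^ k) v $ y = 0"
proof (induction k arbitrary: y)
  case 0
  then show ?case using d_le[of y] by simp
next
  case (Suc k)
  have "(L ^^ k) v $ z = 0" if "cov z y" for z
    using Suc.IH[of z] Suc.prems cov_d[OF that] by simp
  then show ?case by (simp add: L_def[of "(L ^^ k) v"] cong: if_cong)
qed

lemma p_pow_q_pow: "p ^ n * q ^ n = 1"
  using q_p by (simp add: power_mult_distrib[symmetric] mult.commute)

lemma q_pow_gt1: "q ^ Suc n > 1"
  using q_gt1 by (rule power_gt1)

lemma e_pos: "e > 0"
  using q_gt1 by (simp add: e_def)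

context
  fixes v :: "real ^ 'x" and r :: nat
  assumes Lv: "L v = 0" and rank: "\<And>y. d y \<noteq> r \<Longrightarrow> v $ y = 0"
begin

lemma K_R_pow: "K ((R ^^ k) v) = (q ^ r * q ^ k) *\<^sub>R (R ^^ k) v"
proof (induction k)
  case 0
  have "q ^ d y * v $ y = q ^ r * v $ y" for y using rank[of y] by (cases "d y = r") auto
  then show ?case by (simp add: K_def D_def vec_eq_iff)
next
  case (Suc k)
  then show ?case by (simp add: K_R op_linear algebra_simps)
qed

lemma S_R_pow: "S ((R ^^ k) v) = (p ^ r * p ^ k) *\<^sub>R (R ^^ k) v"
proof (induction k)
  case 0
  have "1 / q ^ d y * v $ y = p ^ r * v $ y" for y
    using rank[of y] by (cases "d y = r") (auto simp: p_def power_one_over)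
  then show ?case by (simp add: S_def D_def vec_eq_iff)
next
  case (Suc k)
  then show ?case by (simp add: S_R op_linear algebra_simps)
qed

text \<open>Closed form of the sum over \<open>j \<le> k\<close> of the commutator weights
  \<open>e * (q ^ N * p ^ r * p ^ j - q ^ r * q ^ j)\<close>.\<close>

definition lower_coeff :: "nat \<Rightarrow> real" where
  "lower_coeff k = e * e * (q ^ Suc k - 1) * (q ^ N * p ^ r * p ^ k - q ^ r)"

text \<open>Moving \<open>L\<close> past one more \<open>R\<close> adds one commutator, which acts
  on the string as the scalar given by \<open>K_R_pow\<close> and \<open>S_R_pow\<close>.\<close>

lemma L_R_pow: "L ((R ^^ Suc k) v) = lower_coeff k *\<^sub>R (R ^^ k) v"
proof (induction k)
  case 0
  have eq: "e * (m * s - t) = e * e * (q - 1) * (m * s - t)" for m s t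
    using q_e by algebra
  have "L (R v) = (e * (q ^ N * p ^ r - q ^ r)) *\<^sub>R v"
    using K_R_pow[of 0] S_R_pow[of 0] by (simp add: L_R Lv op_linear algebra_simps)
  then show ?case using eq[of "q ^ N" "p ^ r" "q ^ r"] by (simp add: lower_coeff_def)
next
  case (Suc k)
  have eq: "e * e * (q * a - 1) * (m * s * b - t) + e * (m * (s * (p * b)) - t * (q * a))
     = e * e * (q * (q * a) - 1) * (m * s * (p * b) - t)" if "b * a = 1" for m s t a b
    using q_e q_p that by algebra
  have "L ((R ^^ Suc (Suc k)) v) = R (L ((R ^^ Suc k) v))
      + e *\<^sub>R (q ^ N *\<^sub>R S ((R ^^ Suc k) v) - K ((R ^^ Suc k) v))"
    using L_R[of "(R ^^ Suc k) v"] by simp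
  also have "\<dots> = (lower_coeff k + e * (q ^ N * (p ^ r * (p * p ^ k)) - q ^ r * (q * q ^ k))) *\<^sub>R (R ^^ Suc k) v"
    unfolding Suc.IH K_R_pow S_R_pow by (simp add: op_linear algebra_simps)
  also have "lower_coeff k + e * (q ^ N * (p ^ r * (p * p ^ k)) - q ^ r * (q * q ^ k)) = lower_coeff (Suc k)"
    using eq[OF p_pow_q_pow[of k], of "q ^ N" "p ^ r" "q ^ r"] by (simp add: lower_coeff_def)
  finally show ?case .
qed

lemma A_R_pow: "A ((R ^^ Suc k) v) = (R ^^ Suc (Suc k)) v + (lower_coeff k * (q ^ r * q ^ k)) *\<^sub>R (R ^^ k) v"
  using L_R_pow[of k] by (simp add: A_def op_linear K_R_pow)

text \<open>These are the coefficients \<open>q ^ (- r k) / [k]!\<close>, where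
  \<open>[j] = (q ^ j - 1) / (q - 1)\<close>.\<close>

definition \<alpha> :: "nat \<Rightarrow> real" where
  "\<alpha> k = (\<Prod>j<k. p ^ r / ((q ^ Suc j - 1) * e))"

lemma \<alpha>_Suc: "\<alpha> (Suc k) * ((q ^ Suc k - 1) * e) = \<alpha> k * p ^ r"
  using q_pow_gt1[of k] e_pos by (simp add: \<alpha>_def)

lemma theta_nat: "theta (int r) = (q ^ N * p ^ r - q ^ r) * e"
  by (simp add: theta_def th_def p_def power_one_over)

text \<open>The eigenvector equation for the weighted string, compared at
  \<open>(R ^^ Suc k) v\<close>.\<close>

lemma \<alpha>_rec: "\<alpha> k + \<alpha> (Suc (Suc k)) * (lower_coeff (Suc k) * (q ^ r * q ^ Suc k)) = theta (int r) * \<alpha> (Suc k)"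
proof -
  have "a + c * (e * e * (q * (q * x) - 1) * (m * s * (p * y) - t) * (t * (q * x))) = (m * s - t) * e * b"
    if "b * ((q * x - 1) * e) = a * s" "c * ((q * (q * x) - 1) * e) = b * s" "s * t = 1" "y * x = 1"
    for a b c x m s y t
    using that q_e q_p by algebra
  from this[OF \<alpha>_Suc[of k, simplified] \<alpha>_Suc[of "Suc k", simplified] p_pow_q_pow p_pow_q_pow]
  show ?thesis by (simp add: theta_nat lower_coeff_def)
qed

text \<open>Truncation leaves two boundary terms: the last summand raised once more, and the
  contribution to \<open>(R ^^ n) v\<close> that the first omitted summand would have made.\<close>

lemma A_partial_sum:
  "A (\<Sum>k\<le>n. \<alpha> k *\<^sub>R (R ^^ k) v) = theta (int r) *\<^sub>R (\<Sum>k\<le>n. \<alpha> k *\<^sub>R (R ^^ k) v)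
    + \<alpha> n *\<^sub>R (R ^^ Suc n) v - (\<alpha> (Suc n) * (lower_coeff n * (q ^ r * q ^ n))) *\<^sub>R (R ^^ n) v"
proof (induction n)
  case 0
  have "c * (e * e * (q - 1) * (m * s - t) * t) = (m * s - t) * e"
    if "c * ((q - 1) * e) = s" "s * t = 1" for c m s t
  proof -
    have "c * (e * e * (q - 1) * (m * s - t) * t) = (c * ((q - 1) * e)) * t * ((m * s - t) * e)"
      by (simp only: ac_simps)
    then show ?thesis using that by simp
  qed
  from this[of "\<alpha> 1"] have "\<alpha> 1 * (lower_coeff 0 * q ^ r) = theta (int r)"
    using \<alpha>_Suc[of 0] p_pow_q_pow[of r] by (simp add: theta_nat lower_coeff_def \<alpha>_def)
  then show ?case by (simp add: A_def Lv op_linear \<alpha>_def)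
next
  case (Suc n)
  let ?w = "\<Sum>k\<le>n. \<alpha> k *\<^sub>R (R ^^ k) v"
  have "A (\<Sum>k\<le>Suc n. \<alpha> k *\<^sub>R (R ^^ k) v) = A ?w + \<alpha> (Suc n) *\<^sub>R A ((R ^^ Suc n) v)"
    by (simp add: op_linear)
  also have "\<dots> = theta (int r) *\<^sub>R ?w + \<alpha> n *\<^sub>R (R ^^ Suc n) v + \<alpha> (Suc n) *\<^sub>R (R ^^ Suc (Suc n)) v"
    unfolding Suc.IH A_R_pow by (simp add: algebra_simps)
  also have "\<alpha> n = theta (int r) * \<alpha> (Suc n) - \<alpha> (Suc (Suc n)) * (lower_coeff (Suc n) * (q ^ r * q ^ Suc n))"
    using \<alpha>_rec[of n] by simp
  finally show ?case by (simp add: algebra_simps)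
qed

lemma lowest_weight_U: "v \<in> U"
proof (cases "r \<le> N")
  case False
  then have "v = 0" using rank d_le by (metis vec_eq_iff zero_index)
  then show ?thesis by (simp add: subspace_0 subspace_U)
next
  case True
  \<comment> \<open>The sum runs to \<open>Suc N\<close>, so that both boundary terms carry a power
    of \<open>R\<close> beyond \<open>N\<close> and vanish.\<close>
  define w where "w = (\<Sum>k\<le>Suc N. \<alpha> k *\<^sub>R (R ^^ k) v)"
  have nil: "(R ^^ k) v = 0" if "N < k" for k
  proof -
    have "(R ^^ k) v $ y = 0" for y
      using that d_le[of y] by (intro R_pow_support) simp
    then show ?thesis by (simp add: vec_eq_iff)
  qed
  have "w \<in> E (theta (int r))"
    using A_partial_sum[of "Suc N"] nil[of "Suc N"] nil[of "Suc (Suc N)"] by (simp add: E_def w_def)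
  then have "w \<in> U" using True by (intro E_U[of "int r"]) auto
  then have "D (\<lambda>n. if n = r then 1 else 0) w \<in> U" by (rule D_U)
  moreover have "D (\<lambda>n. if n = r then 1 else 0) w = v"
  proof -
    \<comment> \<open>On \<open>(R ^^ k) v\<close> the operator \<open>K\<close> acts as
      \<open>q ^ (r + k)\<close>, while at rank \<open>r\<close> it multiplies entries by
      \<open>q ^ r\<close>; so only the summand \<open>k = 0\<close> is visible at rank
      \<open>r\<close>.\<close>
    have off: "(R ^^ k) v $ y = 0" if "d y = r" "0 < k" for y k
    proof -
      have "(q ^ r * q ^ k) * (R ^^ k) v $ y = q ^ r * (R ^^ k) v $ y"
        using arg_cong[OF K_R_pow[of k], of "\<lambda>x. x $ y"] that by (simp add: K_def D_def)
      moreover have "q ^ k \<noteq> 1" using that q_gt1 by (metis one_less_power less_irrefl)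
      ultimately show ?thesis using q_pos by simp
    qed
    have "w $ y = v $ y" if "d y = r" for y
    proof -
      have "w $ y = (\<Sum>k\<le>Suc N. if k = 0 then v $ y else 0)"
        unfolding w_def sum_component
        by (rule sum.cong) (use off[OF that] in \<open>auto simp: \<alpha>_def simp del: funpow.simps\<close>)
      then show ?thesis by simp
    qed
    then show ?thesis using rank by (auto simp: D_def vec_eq_iff)
  qed
  ultimately show ?thesis by simp
qed

end

text \<open>\<open>L\<close> shifts the rank, so the homogeneous components of a vector in its
  kernel lie in the kernel as well.\<close>

lemma ker_L_U:
  assumes "L v = 0"
  shows "v \<in> U"
proof -
  let ?v = "\<lambda>r. D (\<lambda>n. if n = r then 1 else 0) v"
  have "?v r \<in> U" for r
    by (rule lowest_weight_U[of _ r]) (simp_all add: L_D assms op_linear, simp add: D_def)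
  moreover have "v = (\<Sum>r\<le>N. ?v r)"
    using d_le by (simp add: vec_eq_iff D_def sum_distrib_right[symmetric])
  ultimately show ?thesis
    using subspace_sum[OF subspace_U, of "{..N}" ?v] by simp
qed

lemma inner_L_R: "L v \<bullet> w = v \<bullet> R w"
proof -
  have "L v \<bullet> w = (\<Sum>y\<in>UNIV. \<Sum>z\<in>UNIV. if cov z y then v $ z * w $ y else 0)"
    by (auto simp: L_def inner_vec_def sum_distrib_right intro!: sum.cong)
  also have "\<dots> = (\<Sum>z\<in>UNIV. \<Sum>y\<in>UNIV. if cov z y then v $ z * w $ y else 0)"
    by (rule sum.swap)
  also have "\<dots> = v \<bullet> R w"
    by (auto simp: R_def inner_vec_def sum_distrib_left intro!: sum.cong)
  finally show ?thesis .
qed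

lemma U_UNIV: "U = UNIV"
proof (rule ccontr)
  assume "U \<noteq> UNIV"
  then have "span U \<noteq> UNIV" using subspace_U by (metis span_eq_iff)
  then obtain u where u: "u \<noteq> 0" "\<forall>x\<in>U. u \<bullet> x = 0"
    using span_not_UNIV_orthogonal[of U] span_base by blast
  have orth: "\<forall>x\<in>U. (L ^^ k) u \<bullet> x = 0" for k
  proof (induction k)
    case (Suc k)
    then show ?case using R_U by (simp add: inner_L_R)
  qed (simp add: u)
  \<comment> \<open>If \<open>(L ^^ Suc k) u\<close> vanishes, then \<open>(L ^^ k) u\<close> lies
    in \<open>U\<close> and is orthogonal to \<open>U\<close>, hence is zero; this descends to
    \<open>u\<close>.\<close>
  have "(L ^^ k) u = 0 \<Longrightarrow> u = 0" for k
  proof (induction k)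
    case (Suc k)
    then have "(L ^^ k) u \<in> U" by (intro ker_L_U) simp
    then have "(L ^^ k) u = 0" using orth[of k] inner_eq_zero_iff by blast
    then show ?case by (rule Suc.IH)
  qed simp
  moreover have "(L ^^ Suc N) u = 0"
  proof -
    have "(L ^^ Suc N) u $ y = 0" for y by (intro L_pow_support) simp
    then show ?thesis by (simp add: vec_eq_iff)
  qed
  ultimately show False using u by blast
qed

section \<open>Occurrence of every eigenvalue\<close>

lemma R_nth: "R v $ y = (\<Sum>z | cov y z. v $ z)" and L_nth: "L v $ y = (\<Sum>z | cov z y. v $ z)"
  by (simp_all add: R_def L_def sum.If_cases)

text \<open>A factor \<open>A - t\<close> raises the maximal rank of the support by at most one, and
  the new top part comes from \<open>R\<close> alone. \<open>R\<close> has nonnegative entries and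
  every element of rank below \<open>N\<close> has an upper cover, so the top part stays nonnegative
  and nonzero.\<close>

lemma factor_product_support:
  assumes "d y0 = 0" "length ts \<le> N"
  defines "x \<equiv> factor_product A ts (axis y0 1)"
  shows "(\<forall>y. length ts < d y \<longrightarrow> x $ y = 0) \<and> (\<forall>y. length ts = d y \<longrightarrow> 0 \<le> x $ y)
    \<and> (\<exists>y. length ts = d y \<and> 0 < x $ y)"
  using assms(2) unfolding x_def
proof (induction ts)
  case Nil
  then show ?case using assms(1) by (auto simp: axis_def intro!: exI[of _ y0])
next
  case (Cons t ts)
  define x where "x = factor_product A ts (axis y0 1)"
  have z: "\<And>y. length ts < d y \<Longrightarrow> x $ y = 0" and nn: "\<And>y. length ts = d y \<Longrightarrow> 0 \<le> x $ y"
    and ex: "\<exists>y. length ts = d y \<and> 0 < x $ y"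
    using Cons unfolding x_def by auto
  have val: "(A x - t *\<^sub>R x) $ y = R x $ y" if "length ts < d y" for y
    using that z by (simp add: A_def K_def D_def L_nth) (auto intro!: sum.neutral dest: cov_d)
  have R0: "R x $ y = 0" if "Suc (length ts) < d y" for y
    using that z by (auto simp: R_nth intro!: sum.neutral dest: cov_d)
  have Rnn: "\<And>z. cov y z \<Longrightarrow> 0 \<le> x $ z" if "Suc (length ts) = d y" for y
    using that nn cov_d by fastforce
  obtain y where y: "length ts = d y" "0 < x $ y" using ex by blast
  have "q ^ d y < q ^ N" using Cons.prems y q_gt1 by (intro power_strict_increasing) auto
  then have "real (card {z. cov z y}) > 0"
    unfolding card_up using q_gt1 by simp
  then obtain y' where y': "cov y' y" by (metis card.empty empty_Collect_eq less_irrefl of_nat_0)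
  then have dy': "Suc (length ts) = d y'" using cov_d y by simp
  have "x $ y \<le> R x $ y'"
    unfolding R_nth using y' Rnn[OF dy'] by (intro member_le_sum) auto
  then have "0 < R x $ y'" using y by simp
  then show ?case
    using val R0 Rnn dy' unfolding x_def[symmetric]
    by (auto simp: R_nth simp del: vector_minus_component vector_scaleR_component
        intro!: sum_nonneg exI[of _ y'] simp flip: x_def)
qed

text \<open>If one eigenspace were zero, the product of the \<open>N\<close> factors for the other
  indices would kill \<open>U\<close>, the whole space, against the positive entry that it produces
  in rank \<open>N\<close>.\<close>

lemma E_nonzero:
  assumes "i \<in> {0..int N}"
  shows "\<exists>v\<in>E (theta i). v \<noteq> 0"
proof (rule ccontr)
  assume none: "\<not> ?thesis"
  obtain js where js: "set js = {0..int N} - {i}" "distinct js"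
    using finite_distinct_list[of "{0..int N} - {i}"] by auto
  let ?ts = "map theta js"
  have len: "length ?ts = N"
    using js assms distinct_card[of js] by simp
  obtain y0 where y0: "d y0 = 0" using ex_bottom by blast
  have "factor_product A ?ts v = 0" if "v \<in> U" for v
    using that unfolding U_def
  proof (induction rule: span_induct_alt)
    case base
    then show ?case by (rule linear_0[OF linear_factor_product[OF linear_A]])
  next
    case (step c x y)
    then obtain j where j: "j \<in> {0..int N}" "x \<in> E (theta j)" by blast
    have "factor_product A ?ts x = 0"
    proof (cases "j = i")
      case True
      then have "x = 0" using none j by blast
      then show ?thesis by (simp add: linear_0[OF linear_factor_product[OF linear_A]])
    next
      case False
      then have "theta j \<in> set ?ts" using js j by auto
      then have "(\<Prod>t\<leftarrow>?ts. theta j - t) = 0" by (auto simp: prod_list_zero_iff image_iff)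
      then show ?thesis using factor_product_eigen[OF linear_A, of x "theta j" ?ts] j
        by (simp add: E_def)
    qed
    then show ?case
      using step linear_factor_product[OF linear_A, of ?ts] by (simp add: linear_add linear_scale)
  qed
  then have "factor_product A ?ts (axis y0 1) = 0" by (simp add: U_UNIV)
  then show False using factor_product_support[OF y0, of ?ts] len by auto
qed

lemma inj_theta: "inj_on (\<lambda>i. theta (int i)) {0..N}"
proof (rule inj_onI)
  fix i j assume "theta (int i) = theta (int j)"
  then show "i = j"
    using theta_strict_antimono[of "int i" "int j"] theta_strict_antimono[of "int j" "int i"]
    by (cases i j rule: linorder_cases) auto
qed

section \<open>Diagonal matrices and the assembled statement for graded posets\<close>

definition diag :: "(nat \<Rightarrow> real) \<Rightarrow> real ^ 'x ^ 'x" where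
  "diag f = (\<chi> y z. if y = z then f (d y) else 0)"

lemma diag_mult_vec: "diag f *v v = D f v"
proof -
  have "(\<Sum>z\<in>UNIV. (if y = z then f (d y) else 0) * v $ z) = f (d y) * v $ y" for y
    by (simp add: if_distrib[of "\<lambda>c. c * _"] cong: if_cong)
  then show ?thesis by (simp add: vec_eq_iff matrix_vector_mult_def diag_def D_def)
qed

lemma diag_mult: "diag f ** diag g = diag (\<lambda>n. f n * g n)"
  by (simp add: matrix_eq matrix_vector_mul_assoc[symmetric] diag_mult_vec D_D)

lemma diag_add: "diag f + diag g = diag (\<lambda>n. f n + g n)"
  and diag_scale: "c *\<^sub>R diag f = diag (\<lambda>n. c * f n)"
  and diag_one: "mat 1 = diag (\<lambda>_. 1)"
  and diag_zero: "0 = diag (\<lambda>_. 0)"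
  by (simp_all add: diag_def mat_def vec_eq_iff)

lemma diag_cong: "(\<And>n. n \<le> N \<Longrightarrow> f n = g n) \<Longrightarrow> diag f = diag g"
  using d_le by (simp add: diag_def vec_eq_iff)

text \<open>The span consists of all matrices \<open>diag f\<close>, a subalgebra containing the
  generator. Conversely, interpolation produces each \<open>diag f\<close> from powers of the
  generator, whose entries differ between ranks.\<close>

lemma generated_algebra_diag:
  "generated_algebra (diag (\<lambda>n. 1 / q ^ n)) = span ((\<lambda>i. diag (\<lambda>n. if n = i then 1 else 0)) ` {0..N})"
    (is "generated_algebra ?B = span ?I")
proof
  have diag_in: "diag f \<in> span ?I" for f
  proof -
    have "diag f = (\<Sum>i\<in>{0..N}. f i *\<^sub>R diag (\<lambda>n. if n = i then 1 else 0))"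
      using d_le by (auto simp: vec_eq_iff diag_def if_distrib[of "\<lambda>c. _ * c"] cong: if_cong)
    also have "\<dots> \<in> span ?I"
      by (intro span_sum span_scale span_base) auto
    finally show ?thesis .
  qed
  have "subspace (range diag)"
    by (auto simp: subspace_def diag_add diag_scale diag_zero)
  then have "span ?I \<subseteq> range diag" by (intro span_minimal) auto
  then have "span ?I = range diag" using diag_in by auto
  then have "subalgebra (span ?I)"
    using subspace_span[of ?I] by (auto simp: subalgebra_def diag_one diag_mult)
  then show "generated_algebra ?B \<subseteq> span ?I"
    unfolding generated_algebra_def using diag_in by (intro hull_minimal) auto
  let ?G = "generated_algebra ?B"
  have G: "subspace ?G" "mat 1 \<in> ?G" "\<And>P Q. P \<in> ?G \<Longrightarrow> Q \<in> ?G \<Longrightarrow> P ** Q \<in> ?G"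
    using subalgebra_generated[of ?B] by (auto simp: subalgebra_def)
  have B: "?B \<in> ?G" unfolding generated_algebra_def by (rule hull_inc) simp
  have "diag f \<in> ?G" for f
  proof -
    have "\<exists>g\<in>{f. diag f \<in> ?G}. \<forall>n\<le>N. g n = f n"
    proof (rule interpolation_closure[OF inj_inverse_power])
      show "(\<lambda>_. 1) \<in> {f. diag f \<in> ?G}"
        using G(2) by (simp only: diag_one mem_Collect_eq)
    next
      fix f g assume "f \<in> {f. diag f \<in> ?G}" "g \<in> {f. diag f \<in> ?G}"
      then show "(\<lambda>n. f n + g n) \<in> {f. diag f \<in> ?G}"
        using subspace_add[OF G(1)] by (simp only: diag_add[symmetric] mem_Collect_eq)
    next
      fix c f assume "f \<in> {f. diag f \<in> ?G}"
      then show "(\<lambda>n. c * f n) \<in> {f. diag f \<in> ?G}"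
        using subspace_scale[OF G(1)] by (simp only: diag_scale[symmetric] mem_Collect_eq)
    next
      fix f assume "f \<in> {f. diag f \<in> ?G}"
      then have "?B ** diag f \<in> ?G" using G(3)[OF B] by (simp only: mem_Collect_eq)
      then show "(\<lambda>n. 1 / q ^ n * f n) \<in> {f. diag f \<in> ?G}"
        by (simp only: diag_mult mem_Collect_eq)
    qed
    then obtain g where "diag g \<in> ?G" "\<forall>n\<le>N. g n = f n" by blast
    then show ?thesis using diag_cong[of g f] by simp
  qed
  then show "span ?I \<subseteq> ?G" using G(1) by (intro span_minimal) auto
qed

lemma Q_polynomial:
  fixes M :: "real ^ 'x ^ 'x"
  assumes M: "\<And>v. M *v v = A v"
  obtains F where "bij_betw F {0..N} (primitive_idempotents M)"
    and "\<And>i. i \<in> {0..int N} \<Longrightarrow> (*v) (diag (\<lambda>n. 1 / q ^ n)) ` idempotent_space N F i \<subseteq>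
      idempotent_space N F (i - 1) + idempotent_space N F i + idempotent_space N F (i + 1)"
proof -
  have E: "eigenspace M t = E t" for t by (simp add: eigenspace_def E_def M)
  have "(\<Union>i\<in>{0..N}. eigenspace M (theta (int i))) = (\<Union>i\<in>{0..int N}. E (theta i))"
    unfolding E image_int_atLeastAtMost[of 0 N, simplified, symmetric] by simp
  then have total: "span (\<Union>i\<in>{0..N}. eigenspace M (theta (int i))) = UNIV"
    using U_UNIV by (simp add: U_def)
  have nz: "\<exists>v\<in>eigenspace M (theta (int i)). v \<noteq> 0" if "i \<le> N" for i
    using E_nonzero[of "int i"] that by (simp add: E)
  obtain F where F: "bij_betw F {0..N} (primitive_idempotents M)"
    and ran: "\<And>i. i \<le> N \<Longrightarrow> range ((*v) (F i)) = eigenspace M (theta (int i))"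
    using primitive_idempotents_of_eigenspaces[OF inj_theta nz total] by blast
  \<comment> \<open>At \<open>-1\<close> and \<open>N + 1\<close> the conventional value
    \<open>{0}\<close> agrees with the eigenspace, so \<open>theta_S_E\<close> applies without
    boundary cases.\<close>
  have space: "idempotent_space N F i = E (theta i)" if "-1 \<le> i" "i \<le> int N + 1" for i
  proof -
    show ?thesis
    proof (cases "0 \<le> i \<and> i \<le> int N")
      case True
      then show ?thesis using ran[of "nat i"] by (simp add: nat_le_iff idempotent_space_def E)
    next
      case False
      then have "i = -1 \<or> i = int N + 1" using that by linarith
      then have "E (theta i) = {0}" by (elim disjE) (simp_all only: E_outside)
      then show ?thesis unfolding idempotent_space_def if_not_P[OF False] by (rule sym)
    qed
  qed
  have "(*v) (diag (\<lambda>n. 1 / q ^ n)) ` idempotent_space N F i \<subseteq>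
      idempotent_space N F (i - 1) + idempotent_space N F i + idempotent_space N F (i + 1)"
    if i: "i \<in> {0..int N}" for i
  proof (rule image_subsetI)
    fix x assume "x \<in> idempotent_space N F i"
    then have "x \<in> E (theta i)" using i space[of i] by simp
    from theta_S_E[OF this] obtain a b c where
      abc: "a \<in> E (theta (i - 1))" "b \<in> E (theta i)" "c \<in> E (theta (i + 1))" "S x = a + b + c"
      by blast
    have "diag (\<lambda>n. 1 / q ^ n) *v x = a + b + c" using abc(4) by (simp add: diag_mult_vec S_def)
    then show "diag (\<lambda>n. 1 / q ^ n) *v x \<in>
        idempotent_space N F (i - 1) + idempotent_space N F i + idempotent_space N F (i + 1)"
      using abc i space[of "i - 1"] space[of i] space[of "i + 1"] by (auto intro!: set_plus_intro)
  qed
  with F show ?thesis using that by blast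
qed

end

section \<open>Counting subspaces over a finite field\<close>

lemma eq_singleton_if:
  assumes "\<And>z. z \<in> A \<Longrightarrow> z = a \<and> P" and "P \<Longrightarrow> a \<in> A"
  shows "A = (if P then {a} else {})"
  using assms by auto

locale finite_space_over_finite_field =
  finite_dimensional_vector_space scale Basis
  for scale :: "'k::{field,finite} \<Rightarrow> 'v::ab_group_add \<Rightarrow> 'v" (infixr \<open>*s\<close> 75) and Basis
begin

lemma card_span_independent:
  assumes "finite B" "independent B"
  shows "finite (span B) \<and> card (span B) = CARD('k) ^ card B"
  using assms
proof (induction B)
  case empty
  then show ?case by simp
next
  case (insert b B)
  have B: "independent B" "b \<notin> span B"
    using insert.prems insert.hyps by (simp_all add: independent_insert)
  let ?f = "\<lambda>(c, x). c *s b + x"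
  have img: "span (insert b B) = ?f ` (UNIV \<times> span B)"
  proof (intro equalityI subsetI)
    fix x assume "x \<in> span (insert b B)"
    then obtain c where "x - c *s b \<in> span B" by (auto simp: span_insert)
    then show "x \<in> ?f ` (UNIV \<times> span B)" by (intro image_eqI[of _ _ "(c, x - c *s b)"]) auto
  next
    fix x assume "x \<in> ?f ` (UNIV \<times> span B)"
    then obtain c y where "x = c *s b + y" "y \<in> span B" by auto
    then show "x \<in> span (insert b B)" by (auto simp: span_insert intro!: exI[of _ c])
  qed
  have "inj_on ?f (UNIV \<times> span B)"
  proof (rule inj_onI)
    fix u w assume u: "u \<in> UNIV \<times> span B" and w: "w \<in> UNIV \<times> span B" and "?f u = ?f w"
    then obtain c x c' x' where uw: "u = (c, x)" "w = (c', x')" and x: "x \<in> span B" "x' \<in> span B"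
      and eq: "c *s b + x = c' *s b + x'" by auto
    have "(c - c') *s b = x' - x" using eq by (simp add: scale_left_diff_distrib algebra_simps)
    then have "(c - c') *s b \<in> span B" using x by (simp add: span_diff)
    then have "inverse (c - c') *s (c - c') *s b \<in> span B" by (rule span_scale)
    then have "c = c'" using B(2) by (cases "c = c'") simp_all
    then show "u = w" using eq uw by simp
  qed
  then show ?case
    using insert.IH[OF B(1)] insert.hyps unfolding img
    by (simp add: card_image card_cartesian_product)
qed

lemma card_subspace:
  assumes "subspace S"
  shows "card S = CARD('k) ^ dim S" and finite_subspace: "finite S"
proof -
  obtain B where B: "B \<subseteq> S" "independent B" "S \<subseteq> span B" "card B = dim S"
    using basis_exists by blast
  have "span B = S" using B assms span_minimal by blast
  then show "card S = CARD('k) ^ dim S" "finite S"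
    using card_span_independent[of B] B finiteI_independent by auto
qed

lemma finite_subspaces: "finite {S. subspace S \<and> P S}"
proof (rule finite_subset)
  show "finite (Pow (UNIV :: 'v set))" using finite_subspace[OF subspace_UNIV] by (simp only: finite_Pow_iff)
qed simp

lemma CARD_gt1: "1 < CARD('k)"
proof -
  have "card {0, 1 :: 'k} \<le> CARD('k)" by (intro card_mono) auto
  then show ?thesis by simp
qed

text \<open>Each vector of \<open>T - S\<close> spans together with \<open>S\<close> exactly one
  such \<open>W\<close>, so the sets \<open>W - S\<close> partition \<open>T - S\<close>; each has
  \<open>(q - 1) q ^ dim S\<close> elements, where \<open>q = CARD('k)\<close>.\<close>

lemma card_covers_below:
  assumes S: "subspace S" and T: "subspace T" and "S \<subseteq> T"
  shows "card {W. subspace W \<and> S \<subseteq> W \<and> W \<subseteq> T \<and> dim W = Suc (dim S)} * (CARD('k) - 1) * CARD('k) ^ dim S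
    + CARD('k) ^ dim S = CARD('k) ^ dim T"
proof -
  define Cs where "Cs = {W. subspace W \<and> S \<subseteq> W \<and> W \<subseteq> T \<and> dim W = Suc (dim S)}"
  have fin: "finite X" for X :: "'v set"
    using finite_subset[OF subset_UNIV finite_subspace[OF subspace_UNIV]] .
  have span_cover: "W = span (insert x S)" if "W \<in> Cs" "x \<in> W - S" for W x
  proof (rule sym, rule subspace_dim_equal)
    show "span (insert x S) \<subseteq> W" using that by (intro span_minimal) (auto simp: Cs_def)
    show "dim W \<le> dim (span (insert x S))"
      using that S by (simp add: dim_insert Cs_def span_eq_iff[THEN iffD2])
  qed (use that in \<open>auto simp: Cs_def\<close>)
  have "T - S = (\<Union>W\<in>Cs. W - S)"
  proof (intro equalityI subsetI)
    fix x assume x: "x \<in> T - S"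
    have "span (insert x S) \<subseteq> T" using x T \<open>S \<subseteq> T\<close> by (intro span_minimal) auto
    moreover have "S \<subseteq> span (insert x S)" using span_superset[of "insert x S"] by simp
    moreover have "dim (span (insert x S)) = Suc (dim S)"
      using x S by (simp add: dim_insert span_eq_iff[THEN iffD2])
    ultimately have "span (insert x S) \<in> Cs" by (simp add: Cs_def)
    then show "x \<in> (\<Union>W\<in>Cs. W - S)" using x by (auto intro!: bexI[of _ "span (insert x S)"] span_base)
  qed (auto simp: Cs_def)
  moreover have "card (\<Union>W\<in>Cs. W - S) = (\<Sum>W\<in>Cs. card (W - S))"
  proof (rule card_UN_disjoint)
    show "finite Cs" unfolding Cs_def by (rule finite_subspaces)
    have "W = W'" if "W \<in> Cs" "W' \<in> Cs" "x \<in> W - S" "x \<in> W' - S" for W W' x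
      using span_cover[OF that(1,3)] span_cover[OF that(2,4)] by simp
    then show "\<forall>W\<in>Cs. \<forall>W'\<in>Cs. W \<noteq> W' \<longrightarrow> (W - S) \<inter> (W' - S) = {}" by blast
  qed (simp add: fin)
  moreover have "card (W - S) = (CARD('k) - 1) * CARD('k) ^ dim S" if "W \<in> Cs" for W
    using that S card_subspace(1)[of W] card_subspace(1)[of S]
    by (simp add: Cs_def card_Diff_subset fin diff_mult_distrib)
  ultimately have "card (T - S) = card Cs * (CARD('k) - 1) * CARD('k) ^ dim S" by simp
  moreover have "card (T - S) + CARD('k) ^ dim S = CARD('k) ^ dim T"
    using S T \<open>S \<subseteq> T\<close> card_subspace(1)[of T] card_subspace(1)[of S] card_mono[OF fin[of T] \<open>S \<subseteq> T\<close>]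
    by (simp add: card_Diff_subset fin)
  ultimately show ?thesis by (simp add: Cs_def)
qed

text \<open>
  Fix a hyperplane \<open>H0\<close> of \<open>T\<close>.  Every other hyperplane meets \<open>H0\<close> in a hyperplane \<open>M\<close> of \<open>H0\<close>, and
  for each \<open>M\<close> there are \<open>q\<close> of them, so the number of hyperplanes satisfies \<open>h (n + 1) = 1 + q h n\<close>.
\<close>

lemma card_hyperplanes:
  assumes "subspace T"
  shows "card {H. subspace H \<and> H \<subseteq> T \<and> dim T = Suc (dim H)} * (CARD('k) - 1) + 1 = CARD('k) ^ dim T"
  using assms
proof (induction "dim T" arbitrary: T)
  case 0
  then show ?case by (simp add: 0(1)[symmetric] del: dim_eq_0)
next
  case (Suc n)
  define hyp where "hyp T = {H. subspace H \<and> H \<subseteq> T \<and> dim T = Suc (dim H)}" for T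
  define btw where "btw M = {W. subspace W \<and> M \<subseteq> W \<and> W \<subseteq> T \<and> dim W = Suc (dim M)}" for M
  obtain H0 where "subspace H0" "H0 \<subseteq> span T" "dim H0 = n"
    using choose_subspace_of_subspace[of n T] Suc.hyps(2) by auto
  then have H0: "subspace H0" "H0 \<subseteq> T" "dim H0 = n" "H0 \<in> hyp T"
    using Suc.hyps(2) Suc.prems by (auto simp: hyp_def span_eq_iff[THEN iffD2])
  have meet: "H \<inter> H0 \<in> hyp H0" if H: "H \<in> hyp T" "H \<noteq> H0" for H
  proof -
    have sub: "subspace H" "H \<subseteq> T" "dim H = n" using H Suc.hyps(2) by (auto simp: hyp_def)
    let ?J = "{x + y |x y. x \<in> H \<and> y \<in> H0}"
    have J: "subspace ?J" "?J \<subseteq> T"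
      using sub H0 Suc.prems by (auto intro!: subspace_sums subspace_add)
    have HJ: "H \<subseteq> ?J" "H0 \<subseteq> ?J"
      using sub H0 subspace_0[of H] subspace_0[of H0] by force+
    \<comment> \<open>Two distinct subspaces of equal dimension have a strictly larger sum, here all
      of \<open>T\<close>; the dimension formula then gives the intersection.\<close>
    have "\<not> dim ?J \<le> n"
      using subspace_dim_equal[of H ?J] subspace_dim_equal[of H0 ?J] sub H0 J HJ H(2) by auto
    moreover have "dim ?J \<le> Suc n" using dim_subset[OF J(2)] Suc.hyps(2) by simp
    ultimately have "dim ?J = Suc n" by simp
    then have "n = Suc (dim (H \<inter> H0))"
      using dim_sums_Int[of H H0] sub H0 by simp
    then show ?thesis using sub H0 by (auto simp: hyp_def subspace_inter)
  qed
  have fin: "finite (hyp T)" "finite (btw M)" for T M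
    unfolding hyp_def btw_def by (rule finite_subspaces)+
  have "hyp T - {H0} = (\<Union>M\<in>hyp H0. btw M - {H0})"
  proof (intro equalityI subsetI)
    fix H assume H: "H \<in> hyp T - {H0}"
    have "H \<inter> H0 \<in> hyp H0" using H meet by blast
    moreover have "H \<in> btw (H \<inter> H0) - {H0}"
      using H calculation H0 Suc.hyps(2) by (auto simp: hyp_def btw_def)
    ultimately show "H \<in> (\<Union>M\<in>hyp H0. btw M - {H0})" by blast
  qed (use H0 Suc.hyps(2) in \<open>auto simp: hyp_def btw_def\<close>)
  moreover have "M = H \<inter> H0" if "M \<in> hyp H0" "H \<in> btw M - {H0}" for M H
  proof (rule subspace_dim_equal)
    have "H \<in> hyp T" using that H0 Suc.hyps(2) by (auto simp: hyp_def btw_def)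
    then have "H \<inter> H0 \<in> hyp H0" using that meet by blast
    then show "dim (H \<inter> H0) \<le> dim M" using that by (auto simp: hyp_def)
  qed (use that H0 in \<open>auto simp: hyp_def btw_def subspace_inter\<close>)
  then have "card (\<Union>M\<in>hyp H0. btw M - {H0}) = (\<Sum>M\<in>hyp H0. card (btw M - {H0}))"
    using fin by (intro card_UN_disjoint) blast+
  moreover have "card (btw M - {H0}) = CARD('k)" if M: "M \<in> hyp H0" for M
  proof -
    let ?q = "CARD('k)"
    have M': "subspace M" "M \<subseteq> T" "dim T = Suc (Suc (dim M))"
      using M H0 Suc.hyps(2) by (auto simp: hyp_def)
    have "H0 \<in> btw M" using M H0 by (auto simp: hyp_def btw_def)
    \<comment> \<open>\<open>M\<close> has codimension two in \<open>T\<close>, so there are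
      \<open>q + 1\<close> subspaces strictly between them, one of which is
      \<open>H0\<close>.\<close>
    have "card (btw M) * (?q - 1) * ?q ^ dim M + ?q ^ dim M = ?q ^ dim T"
      using card_covers_below[OF M'(1) Suc.prems M'(2)] by (simp add: btw_def)
    also have "\<dots> = (?q * ?q) * ?q ^ dim M" by (simp add: M'(3))
    finally have "(card (btw M) * (?q - 1) + 1) * ?q ^ dim M = (?q * ?q) * ?q ^ dim M"
      by (simp add: algebra_simps)
    then have "card (btw M) * (?q - 1) + 1 = ?q * ?q \<or> ?q ^ dim M = 0"
      by (simp only: mult_cancel2)
    then have "card (btw M) * (?q - 1) + 1 = ?q * ?q" using CARD_gt1 by simp
    \<comment> \<open>Writing \<open>q = k + 2\<close> turns
      \<open>q * q - 1 = (q - 1) * (q + 1)\<close> into an identity without truncated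
      subtraction.\<close>
    moreover obtain k where "?q = Suc (Suc k)" using CARD_gt1 less_iff_Suc_add by auto
    ultimately have "card (btw M) * Suc k = (k + 3) * Suc k" by (simp add: algebra_simps)
    then have "card (btw M) = Suc ?q" using \<open>?q = Suc (Suc k)\<close> by (simp only: mult_cancel2) simp
    then show ?thesis using \<open>H0 \<in> btw M\<close> by (simp add: card_Diff_singleton)
  qed
  ultimately have "card (hyp T - {H0}) = card (hyp H0) * CARD('k)" by simp
  then have "card (hyp T) = Suc (card (hyp H0) * CARD('k))"
    using H0(4) fin(1)[of T] by (metis card_Suc_Diff1)
  have IH: "card (hyp H0) * (CARD('k) - 1) + 1 = CARD('k) ^ n"
    using Suc.hyps(1)[of H0] H0 by (simp add: hyp_def)
  obtain k where k: "CARD('k) = Suc k" using CARD_gt1 less_iff_Suc_add by auto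
  have "card (hyp T) * k + 1 = Suc k * (card (hyp H0) * k + 1)"
    using \<open>card (hyp T) = _\<close> k by (simp add: algebra_simps)
  also have "\<dots> = CARD('k) ^ Suc n"
    by (simp only: IH[unfolded k diff_Suc_1] k power_Suc)
  finally have "card (hyp T) * (CARD('k) - 1) + 1 = CARD('k) ^ Suc n"
    by (simp only: k diff_Suc_1)
  then show ?case using Suc.hyps(2) by (simp add: hyp_def)
qed

text \<open>The only possible common upper cover is \<open>Y + W\<close> and the only possible
  common lower cover is the intersection. By the dimension formula both occur or neither
  does.\<close>

lemma card_common_covers:
  assumes Y: "subspace Y" and W: "subspace W" and "Y \<noteq> W" and eq: "dim Y = dim W"
  shows "card {Z. subspace Z \<and> (Y \<subseteq> Z \<and> dim Z = dim Y + 1) \<and> (W \<subseteq> Z \<and> dim Z = dim W + 1)}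
    = card {Z. subspace Z \<and> (Z \<subseteq> Y \<and> dim Y = dim Z + 1) \<and> (Z \<subseteq> W \<and> dim W = dim Z + 1)}"
    (is "card ?up = card ?down")
proof -
  define J where "J = {x + y |x y. x \<in> Y \<and> y \<in> W}"
  have J: "subspace J" unfolding J_def using Y W by (rule subspace_sums)
  have sub: "Y \<subseteq> J" "W \<subseteq> J"
    unfolding J_def using subspace_0[OF Y] subspace_0[OF W] by force+
  have I: "subspace (Y \<inter> W)" using Y W by (rule subspace_inter)
  have modular: "dim J + dim (Y \<inter> W) = 2 * dim Y"
    using dim_sums_Int[OF Y W] eq by (simp add: J_def)
  have gt: "dim Y < dim J"
  proof (rule ccontr)
    assume "\<not> ?thesis"
    then have "Y = J" "W = J"
      using subspace_dim_equal[OF Y J sub(1)] subspace_dim_equal[OF W J sub(2)] eq by auto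
    then show False using \<open>Y \<noteq> W\<close> by simp
  qed
  have up: "?up = (if dim J = dim Y + 1 then {J} else {})"
  proof -
    have "Z = J \<and> dim J = dim Y + 1"
      if "subspace Z" "Y \<subseteq> Z" "dim Z = dim Y + 1" "W \<subseteq> Z" for Z
    proof -
      have le: "J \<subseteq> Z" unfolding J_def using that by (auto intro!: subspace_add)
      have eq': "dim J = dim Z" using dim_subset[OF le] gt that(3) by linarith
      then have "Z = J" by (intro subspace_dim_equal[OF J that(1) le, symmetric]) simp
      moreover have "dim J = dim Y + 1" using eq' that(3) by simp
      ultimately show ?thesis by (rule conjI)
    qed
    then have "Z = J \<and> dim J = dim Y + 1" if "Z \<in> ?up" for Z using that by blast
    moreover have "J \<in> ?up" if "dim J = dim Y + 1" using that J sub eq by simp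
    ultimately show ?thesis by (intro eq_singleton_if)
  qed
  have down: "?down = (if dim Y = dim (Y \<inter> W) + 1 then {Y \<inter> W} else {})"
  proof -
    have "Z = Y \<inter> W \<and> dim Y = dim (Y \<inter> W) + 1"
      if "subspace Z" "Z \<subseteq> Y" "dim Y = dim Z + 1" "Z \<subseteq> W" for Z
    proof -
      have le: "Z \<subseteq> Y \<inter> W" using that by auto
      have eq': "dim (Y \<inter> W) = dim Z" using dim_subset[OF le] gt modular that(3) by linarith
      then have "Z = Y \<inter> W" by (intro subspace_dim_equal[OF that(1) I le]) simp
      moreover have "dim Y = dim (Y \<inter> W) + 1" using eq' that(3) by simp
      ultimately show ?thesis by (rule conjI)
    qed
    then have "Z = Y \<inter> W \<and> dim Y = dim (Y \<inter> W) + 1" if "Z \<in> ?down" for Z using that by blast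
    moreover have "Y \<inter> W \<in> ?down" if "dim Y = dim (Y \<inter> W) + 1" using that I eq by simp
    ultimately show ?thesis by (intro eq_singleton_if)
  qed
  have "dim J = dim Y + 1 \<longleftrightarrow> dim Y = dim (Y \<inter> W) + 1" using modular by linarith
  then show ?thesis unfolding up down by simp
qed

text \<open>\<open>X\<close> merely renames the subspaces, so the counts required by the locale are
  the subspace counts just obtained, moved along the bijection.\<close>

lemma q_graded_subspaces:
  fixes X :: "'x::finite \<Rightarrow> 'v set"
  assumes X: "bij_betw X UNIV {S. subspace S}" and N: "dim UNIV = N"
  shows "q_graded (real CARD('k)) N (\<lambda>y. dim (X y)) (\<lambda>y z. covers scale (X y) (X z))"
proof -
  let ?q = "real CARD('k)"
  have sub: "subspace (X y)" for y using X by (auto simp: bij_betw_def)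
  have card_X: "card {z. P (X z)} = card {S. subspace S \<and> P S}" for P
  proof (rule bij_betw_same_card)
    have "{S. subspace S \<and> P S} = {S \<in> range X. P S}" using X by (auto simp: bij_betw_def)
    also have "\<dots> = X ` {z. P (X z)}" by auto
    finally show "bij_betw X {z. P (X z)} {S. subspace S \<and> P S}"
      using X by (simp add: bij_betw_def inj_on_def)
  qed
  have q: "?q > 1" using CARD_gt1 by simp
  show ?thesis
  proof
    show "?q > 1" by (rule q)
    show "dim (X y) \<le> N" for y using dim_subset[OF subset_UNIV, of "X y"] N by simp
    show "covers scale (X y) (X z) \<Longrightarrow> dim (X y) = Suc (dim (X z))" for y z
      by (simp add: covers_def)
    show "real (card {z. covers scale (X z) (X y)}) = (?q ^ N / ?q ^ dim (X y) - 1) / (?q - 1)" for y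
    proof -
      have "card {z. covers scale (X z) (X y)} * (CARD('k) - 1) * CARD('k) ^ dim (X y)
          + CARD('k) ^ dim (X y) = CARD('k) ^ N"
        using card_covers_below[OF sub subspace_UNIV, of y] N
        by (simp add: covers_def card_X[of "\<lambda>S. X y \<subseteq> S \<and> dim S = Suc (dim (X y))"])
      from arg_cong[OF this, of real]
      have "real (card {z. covers scale (X z) (X y)}) * (?q - 1) * ?q ^ dim (X y)
          + ?q ^ dim (X y) = ?q ^ N"
        using CARD_gt1 by (simp add: of_nat_diff)
      then show ?thesis using q by (simp add: field_simps)
    qed
    show "real (card {z. covers scale (X y) (X z)}) = (?q ^ dim (X y) - 1) / (?q - 1)" for y
    proof -
      have "card {z. covers scale (X y) (X z)} * (CARD('k) - 1) + 1 = CARD('k) ^ dim (X y)"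
        using card_hyperplanes[OF sub, of y]
        by (simp add: covers_def card_X[of "\<lambda>S. S \<subseteq> X y \<and> dim (X y) = Suc (dim S)"])
      from arg_cong[OF this, of real]
      have "real (card {z. covers scale (X y) (X z)}) * (?q - 1) + 1 = ?q ^ dim (X y)"
        using CARD_gt1 by (simp add: of_nat_diff)
      then show ?thesis using q by (simp add: field_simps)
    qed
    show "card {z. covers scale (X z) (X y) \<and> covers scale (X z) (X w)}
        = card {z. covers scale (X y) (X z) \<and> covers scale (X w) (X z)}"
      if "y \<noteq> w" "dim (X y) = dim (X w)" for y w
    proof -
      have "X y \<noteq> X w" using that(1) X by (auto simp: bij_betw_def inj_on_def)
      from card_common_covers[OF sub sub this that(2)] show ?thesis
        unfolding covers_def
        by (simp only: card_X[of "\<lambda>S. (X y \<subseteq> S \<and> dim S = dim (X y) + 1) \<and> X w \<subseteq> S \<and> dim S = dim (X w) + 1"]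
            card_X[of "\<lambda>S. (S \<subseteq> X y \<and> dim (X y) = dim S + 1) \<and> S \<subseteq> X w \<and> dim (X w) = dim S + 1"])
    qed
    have "{0} \<in> range X" using bij_betw_imp_surj_on[OF X] subspace_single_0 by simp
    then obtain y where "X y = {0}" by (metis imageE)
    then show "\<exists>y. dim (X y) = 0" by (intro exI[of _ y]) simp
  qed
qed

end

theorem theorem8p4:
  fixes smul :: "'k::{field,finite} \<Rightarrow> 'v::ab_group_add \<Rightarrow> 'v"
    and N :: nat
    and X :: "'x::finite \<Rightarrow> 'v set"
  assumes "vector_space smul"
    and "vector_space.dim smul (UNIV :: 'v set) = N"
    and "N \<ge> 1"
    and "bij_betw X UNIV {S. module.subspace smul S}"
  shows "\<exists>(F :: nat \<Rightarrow> real ^ 'x ^ 'x) (B :: real ^ 'x ^ 'x).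
           bij_betw F {0..N} (primitive_idempotents (weighted_adjacency smul X)) \<and>
           generated_algebra B = dual_adjacency_algebra smul N X \<and>
           (\<forall>i\<in>{0..int N}.
              (*v) B ` idempotent_space N F i \<subseteq>
                idempotent_space N F (i - 1) + idempotent_space N F i + idempotent_space N F (i + 1))"
proof -
  interpret vector_space smul by fact
  obtain B where B: "independent B" "span B = UNIV" "card B = N"
    using basis_exists[of UNIV] assms(2) by (metis top.extremum_uniqueI)
  \<comment> \<open>An infinite set has \<open>card\<close> equal to 0, so \<open>N \<ge> 1\<close>
    forces the basis to be finite.\<close>
  then have "finite B" using assms(3) by (metis card.infinite not_one_le_zero)
  interpret finite_space_over_finite_field smul B
    by unfold_locales (use B \<open>finite B\<close> in auto)
  interpret G: q_graded "real CARD('k)" N "\<lambda>y. dim (X y)" "\<lambda>y z. covers smul (X y) (X z)"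
    using assms(2,4) by (intro q_graded_subspaces) auto
  have "weighted_adjacency smul X *v v = G.A v" for v
  proof -
    have "(weighted_adjacency smul X *v v) $ y = G.A v $ y" for y
    proof -
      \<comment> \<open>Covering is asymmetric, so the nested case distinction in the matrix entry
        splits into a sum of a raising and a lowering term.\<close>
      have "\<not> (covers smul (X y) (X z) \<and> covers smul (X z) (X y))" for z
        by (auto dest!: G.cov_d)
      then have "(weighted_adjacency smul X *v v) $ y =
          (\<Sum>z\<in>UNIV. (if covers smul (X y) (X z) then v $ z else 0)
            + real CARD('k) ^ dim (X y) * (if covers smul (X z) (X y) then v $ z else 0))"
        unfolding weighted_adjacency_def matrix_vector_mult_def vec_lambda_beta
        by (intro sum.cong) auto
      also have "\<dots> = G.A v $ y"
        by (simp add: sum.distrib sum_distrib_left G.A_def G.R_def G.L_def G.K_def G.D_def)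
      finally show ?thesis .
    qed
    then show ?thesis by (simp add: vec_eq_iff)
  qed
  from G.Q_polynomial[OF this] obtain F where
    F: "bij_betw F {0..N} (primitive_idempotents (weighted_adjacency smul X))"
    and incl: "\<And>i. i \<in> {0..int N} \<Longrightarrow>
      (*v) (G.diag (\<lambda>n. 1 / real CARD('k) ^ n)) ` idempotent_space N F i \<subseteq>
      idempotent_space N F (i - 1) + idempotent_space N F i + idempotent_space N F (i + 1)"
    by blast
  have "dual_idempotent smul X i = G.diag (\<lambda>n. if n = i then 1 else 0)" for i
    by (simp add: dual_idempotent_def G.diag_def vec_eq_iff)
  then have "generated_algebra (G.diag (\<lambda>n. 1 / real CARD('k) ^ n)) = dual_adjacency_algebra smul N X"
    unfolding G.generated_algebra_diag dual_adjacency_algebra_def by simp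
  with F incl show ?thesis by blast
qed

end
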